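(* Let $\pi:X\to Y$ be a factor code between irreducible shifts of finite type $X$ and $Y$. Then $\pi$ is bi-class-closing if and only if it is constant-class-to-one.
   Context: Shift spaces are closed shift-invariant subsets of $\mathcal{A}^{\mathbb{Z}}$ for a finite alphabet $\mathcal{A}$; $\mathcal{B}(X)$ is the set of words occurring in points of $X$; $X$ is irreducible if for all $u,v\in\mathcal{B}(X)$ there is $w$ with $uwv\in\mathcal{B}(X)$. $X$ is a shift of finite type if for some $k\ge 0$ every $w\in\mathcal{B}(X)$ of length $k$ satisfies: $uw,wv\in\mathcal{B}(X)$ implies $uwv\in\mathcal{B}(X)$. A factor code is a continuous shift-commuting surjection. Two points $x,x'$ are left (resp. right) asymptotic if $x|_{(-\infty,n]}=x'|_{(-\infty,n]}$ (resp. $x|_{[n,\infty)}=x'|_{[n,\infty)}$) for some $n\in\mathbb{Z}$. Let $x,x'\in X$ with $\pi(x)=\pi(x')$ and $m\in\mathbb{Z}$. A right $m$-bridge from $x$ to $x'$ is a point $z\in X$ with $\pi(z)=\pi(x)$ such that for some $n>m$, $z|_{(-\infty,m]}=x|_{(-\infty,m]}$ and $z|_{[n,\infty)}=x'|_{[n,\infty)}$. A left $m$-bridge from $x$ to $x'$ is a point $z\in X$ with $\pi(z)=\pi(x)$ such that for some $n<m$, $z|_{(-\infty,n]}=x'|_{(-\infty,n]}$ and $z|_{[m,\infty)}=x|_{[m,\infty)}$. Write $x\to^r x'$ (resp. $x\to^l x'$) if for every $m\in\mathbb{Z}$ there is a right (resp. left) $m$-bridge from $x$ to $x'$. Points $x,x'$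 in the same fibre are right equivalent if $x\to^r x'$ and $x'\to^r x$, and left equivalent if $x\to^l x'$ and $x'\to^l x$. $\pi$ is right (resp. left) class-closing if any two left (resp. right) asymptotic points $x,x'\in X$ with $\pi(x)=\pi(x')$ are right (resp. left) equivalent; it is bi-class-closing if it is both. For $y\in Y$, $d_\pi^r(y)$ is the number of right equivalence classes in $\pi^{-1}(y)$ (always finite), and the class degree of $\pi$ is $d_\pi=\min_{y\in Y}d_\pi^r(y)$. $\pi$ is constant-class-to-one if $d_\pi^r(y)=d_\pi$ for all $y\in Y$. *)

theory Defs
  imports "HOL-Analysis.Analysis"
begin

section \<open>Shift spaces\<close>

text \<open>The alphabet is the universe of a finite type with the discrete topology; a shift space over
  it is a set of bi-infinite sequences \<open>int \<Rightarrow> 'a\<close>.\<close>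

definition full_shift_topology :: "(int \<Rightarrow> 'a::finite) topology" where
  "full_shift_topology = product_topology (\<lambda>_. discrete_topology UNIV) UNIV"

definition shift :: "(int \<Rightarrow> 'a) \<Rightarrow> int \<Rightarrow> 'a" where
  "shift x = (\<lambda>i. x (i + 1))"

text \<open>Invariance under the two-sided shift means equality; the inclusion
  \<open>shift ` X \<subseteq> X\<close> would be strictly weaker. The empty shift space is not excluded.\<close>

definition shift_space :: "(int \<Rightarrow> 'a::finite) set \<Rightarrow> bool" where
  "shift_space X \<longleftrightarrow> closedin full_shift_topology X \<and> shift ` X = X"

definition language :: "(int \<Rightarrow> 'a) set \<Rightarrow> 'a list set" where
  "language X = {map (\<lambda>k. x (i + int k)) [0..<n] | x i n. x \<in> X}"

definition irreducible_shift :: "(int \<Rightarrow> 'a::finite) set \<Rightarrow> bool" where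
  "irreducible_shift X \<longleftrightarrow>
     shift_space X \<and> (\<forall>u\<in>language X. \<forall>v\<in>language X. \<exists>w. u @ w @ v \<in> language X)"

definition shift_of_finite_type :: "(int \<Rightarrow> 'a::finite) set \<Rightarrow> bool" where
  "shift_of_finite_type X \<longleftrightarrow>
     shift_space X \<and>
     (\<exists>k. \<forall>w\<in>language X. length w = k \<longrightarrow>
        (\<forall>u v. u @ w \<in> language X \<longrightarrow> w @ v \<in> language X \<longrightarrow> u @ w @ v \<in> language X))"

text \<open>Only the values of \<open>\<pi>\<close> on \<open>X\<close> matter, here and below.\<close>

definition factor_code ::
  "(int \<Rightarrow> 'a::finite) set \<Rightarrow> (int \<Rightarrow> 'b::finite) set \<Rightarrow> ((int \<Rightarrow> 'a) \<Rightarrow> (int \<Rightarrow> 'b)) \<Rightarrow> bool" where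
  "factor_code X Y \<pi> \<longleftrightarrow>
     continuous_map (subtopology full_shift_topology X) (subtopology full_shift_topology Y) \<pi> \<and>
     (\<forall>x\<in>X. \<pi> (shift x) = shift (\<pi> x)) \<and>
     \<pi> ` X = Y"


section \<open>Asymptotic points, bridges and equivalence\<close>

definition left_asymptotic :: "(int \<Rightarrow> 'a) \<Rightarrow> (int \<Rightarrow> 'a) \<Rightarrow> bool" where
  "left_asymptotic x x' \<longleftrightarrow> (\<exists>n. \<forall>i\<le>n. x i = x' i)"

definition right_asymptotic :: "(int \<Rightarrow> 'a) \<Rightarrow> (int \<Rightarrow> 'a) \<Rightarrow> bool" where
  "right_asymptotic x x' \<longleftrightarrow> (\<exists>n. \<forall>i\<ge>n. x i = x' i)"

definition right_bridge ::
  "(int \<Rightarrow> 'a) set \<Rightarrow> ((int \<Rightarrow> 'a) \<Rightarrow> (int \<Rightarrow> 'b)) \<Rightarrow> int \<Rightarrow>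
     (int \<Rightarrow> 'a) \<Rightarrow> (int \<Rightarrow> 'a) \<Rightarrow> (int \<Rightarrow> 'a) \<Rightarrow> bool" where
  "right_bridge X \<pi> m x x' z \<longleftrightarrow>
     z \<in> X \<and> \<pi> z = \<pi> x \<and> (\<exists>n>m. (\<forall>i\<le>m. z i = x i) \<and> (\<forall>i\<ge>n. z i = x' i))"

definition left_bridge ::
  "(int \<Rightarrow> 'a) set \<Rightarrow> ((int \<Rightarrow> 'a) \<Rightarrow> (int \<Rightarrow> 'b)) \<Rightarrow> int \<Rightarrow>
     (int \<Rightarrow> 'a) \<Rightarrow> (int \<Rightarrow> 'a) \<Rightarrow> (int \<Rightarrow> 'a) \<Rightarrow> bool" where
  "left_bridge X \<pi> m x x' z \<longleftrightarrow>
     z \<in> X \<and> \<pi> z = \<pi> x \<and> (\<exists>n<m. (\<forall>i\<le>n. z i = x' i) \<and> (\<forall>i\<ge>m. z i = x i))"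

definition right_transition ::
  "(int \<Rightarrow> 'a) set \<Rightarrow> ((int \<Rightarrow> 'a) \<Rightarrow> (int \<Rightarrow> 'b)) \<Rightarrow> (int \<Rightarrow> 'a) \<Rightarrow> (int \<Rightarrow> 'a) \<Rightarrow> bool" where
  "right_transition X \<pi> x x' \<longleftrightarrow> (\<forall>m. \<exists>z. right_bridge X \<pi> m x x' z)"

definition left_transition ::
  "(int \<Rightarrow> 'a) set \<Rightarrow> ((int \<Rightarrow> 'a) \<Rightarrow> (int \<Rightarrow> 'b)) \<Rightarrow> (int \<Rightarrow> 'a) \<Rightarrow> (int \<Rightarrow> 'a) \<Rightarrow> bool" where
  "left_transition X \<pi> x x' \<longleftrightarrow> (\<forall>m. \<exists>z. left_bridge X \<pi> m x x' z)"

definition right_equivalent ::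
  "(int \<Rightarrow> 'a) set \<Rightarrow> ((int \<Rightarrow> 'a) \<Rightarrow> (int \<Rightarrow> 'b)) \<Rightarrow> (int \<Rightarrow> 'a) \<Rightarrow> (int \<Rightarrow> 'a) \<Rightarrow> bool" where
  "right_equivalent X \<pi> x x' \<longleftrightarrow>
     x \<in> X \<and> x' \<in> X \<and> \<pi> x = \<pi> x' \<and> right_transition X \<pi> x x' \<and> right_transition X \<pi> x' x"

definition left_equivalent ::
  "(int \<Rightarrow> 'a) set \<Rightarrow> ((int \<Rightarrow> 'a) \<Rightarrow> (int \<Rightarrow> 'b)) \<Rightarrow> (int \<Rightarrow> 'a) \<Rightarrow> (int \<Rightarrow> 'a) \<Rightarrow> bool" where
  "left_equivalent X \<pi> x x' \<longleftrightarrow>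
     x \<in> X \<and> x' \<in> X \<and> \<pi> x = \<pi> x' \<and> left_transition X \<pi> x x' \<and> left_transition X \<pi> x' x"


section \<open>Class-closing and constant-class-to-one codes\<close>

definition right_class_closing ::
  "(int \<Rightarrow> 'a) set \<Rightarrow> ((int \<Rightarrow> 'a) \<Rightarrow> (int \<Rightarrow> 'b)) \<Rightarrow> bool" where
  "right_class_closing X \<pi> \<longleftrightarrow>
     (\<forall>x\<in>X. \<forall>x'\<in>X. left_asymptotic x x' \<longrightarrow> \<pi> x = \<pi> x' \<longrightarrow> right_equivalent X \<pi> x x')"

definition left_class_closing ::
  "(int \<Rightarrow> 'a) set \<Rightarrow> ((int \<Rightarrow> 'a) \<Rightarrow> (int \<Rightarrow> 'b)) \<Rightarrow> bool" where
  "left_class_closing X \<pi> \<longleftrightarrow>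
     (\<forall>x\<in>X. \<forall>x'\<in>X. right_asymptotic x x' \<longrightarrow> \<pi> x = \<pi> x' \<longrightarrow> left_equivalent X \<pi> x x')"

definition bi_class_closing ::
  "(int \<Rightarrow> 'a) set \<Rightarrow> ((int \<Rightarrow> 'a) \<Rightarrow> (int \<Rightarrow> 'b)) \<Rightarrow> bool" where
  "bi_class_closing X \<pi> \<longleftrightarrow> right_class_closing X \<pi> \<and> left_class_closing X \<pi>"

definition right_classes ::
  "(int \<Rightarrow> 'a) set \<Rightarrow> ((int \<Rightarrow> 'a) \<Rightarrow> (int \<Rightarrow> 'b)) \<Rightarrow> (int \<Rightarrow> 'b) \<Rightarrow> (int \<Rightarrow> 'a) set set" where
  "right_classes X \<pi> y = {x \<in> X. \<pi> x = y} // {(x, x'). right_equivalent X \<pi> x x'}"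

text \<open>For a factor code on a shift of finite type every fibre has finitely many classes, so the
  value \<open>0\<close> that \<open>card\<close> assigns to infinite sets plays no role.\<close>

definition num_right_classes ::
  "(int \<Rightarrow> 'a) set \<Rightarrow> ((int \<Rightarrow> 'a) \<Rightarrow> (int \<Rightarrow> 'b)) \<Rightarrow> (int \<Rightarrow> 'b) \<Rightarrow> nat" where
  "num_right_classes X \<pi> y = card (right_classes X \<pi> y)"

text \<open>For a nonempty set of natural numbers the infimum is attained, so this is the minimum
  (\<open>Min\<close> would presuppose that the set of values is finite).\<close>

definition class_degree ::
  "(int \<Rightarrow> 'a) set \<Rightarrow> (int \<Rightarrow> 'b) set \<Rightarrow> ((int \<Rightarrow> 'a) \<Rightarrow> (int \<Rightarrow> 'b)) \<Rightarrow> nat" where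
  "class_degree X Y \<pi> = (INF y\<in>Y. num_right_classes X \<pi> y)"

definition constant_class_to_one ::
  "(int \<Rightarrow> 'a) set \<Rightarrow> (int \<Rightarrow> 'b) set \<Rightarrow> ((int \<Rightarrow> 'a) \<Rightarrow> (int \<Rightarrow> 'b)) \<Rightarrow> bool" where
  "constant_class_to_one X Y \<pi> \<longleftrightarrow> (\<forall>y\<in>Y. num_right_classes X \<pi> y = class_degree X Y \<pi>)"

end

theory Submission
  imports Defs
begin

text \<open>
Fix a length \<open>K\<close> that is long enough for points of \<open>X\<close>, and of \<open>Y\<close>, to be spliced wherever they
  agree on \<open>K\<close> consecutive coordinates, and for the splice of two points of a fibre to stay in that
  fibre. The word of length \<open>K\<close> that a point \<open>x\<close> shows at coordinate \<open>n\<close> is its \<^emph>\<open>state\<close> at \<open>n\<close>. A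
  \<^emph>\<open>routing\<close> of \<open>y\<close> is a window \<open>[a, b]\<close>, a coordinate \<open>n\<close> in it and a finite set \<open>M\<close> of states such
  that every preimage of the word of \<open>y\<close> on \<open>[a, b]\<close> can be changed inside the window, keeping its
  image, so that its state at \<open>n\<close> lies in \<open>M\<close>. The least size of such an \<open>M\<close> over all points of \<open>Y\<close> is
  called \<open>depth\<close>, and a routing of that size is \<^emph>\<open>minimal\<close>.

  The depth is the class degree. By compactness a fibre with \<open>e\<close> right classes has a routing through
  one state for each class, so \<open>e\<close> is at least the depth (\<open>routing_from_right_classes\<close>). In the other
  direction, a point of \<open>Y\<close> with minimal routings arbitrarily far to the right has at most \<open>depth\<close>
  right classes, because two preimages that are routed through the same state can be switched there.

  Suppose that every fibre has exactly \<open>depth\<close> right classes. Then every point of \<open>Y\<close> has a minimal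
  routing, and by compactness these occur with bounded gaps. Minimal routings are rigid: two points of
  a fibre that share a state anywhere to the left of a minimal routing, or anywhere to its right, pass
  through it in the same state (\<open>minimal_routing_state_forward\<close>, \<open>minimal_routing_state_backward\<close>).
  Asymptotic points of a fibre therefore meet, after rerouting, in any minimal routing far out on the
  other side, which yields all the bridges. Rigidity comes from the semigroup of relations on \<open>M\<close> that
  record which state can follow which between two occurrences of the window. Irreducibility of \<open>X\<close>
  makes it transitive, and minimality says that no state of \<open>M\<close> can be bypassed. An idempotent in such
  a semigroup is the identity, since two distinct comparable states could be made mutually reachable
  and then one of them would be superfluous; so all the relations are permutations.

  Conversely, suppose that \<open>\<pi>\<close> is bi-class-closing. By compactness the bridges given by right
  class-closing have a uniform length, and this makes \<open>\<pi>\<close> right continuing: a point of \<open>Y\<close> that agrees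
  with \<open>\<pi> x\<close> up to some coordinate lifts to a point that agrees with \<open>x\<close> up to a bounded distance before
  it (\<open>right_continuing\<close>). Given \<open>y\<close> and a coordinate, replace a far right end of \<open>y\<close> by one that contains
  a minimal routing, lift all preimages of \<open>y\<close> accordingly and route the lifts. Two lifts with the same
  state in the routing can be made right asymptotic, so left class-closing gives a bridge between them
  that lies over the unchanged part of \<open>y\<close>. Hence there are at most \<open>depth\<close> right classes over \<open>y\<close>.
\<close>

section \<open>Compactness of the full shift\<close>

definition agree :: "int \<Rightarrow> (int \<Rightarrow> 'a) \<Rightarrow> (int \<Rightarrow> 'a) \<Rightarrow> bool" where
  "agree N x x' \<longleftrightarrow> (\<forall>j. \<bar>j\<bar> \<le> N \<longrightarrow> x j = x' j)"

lemma agreeD: "agree N x x' \<Longrightarrow> \<bar>j\<bar> \<le> N \<Longrightarrow> x j = x' j"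
  by (simp add: agree_def)

lemma openin_cylinder: "openin full_shift_topology {x. agree N x (z :: int \<Rightarrow> 'a::finite)}"
proof -
  define C where "C = (\<lambda>j. if \<bar>j\<bar> \<le> N then {z j} else UNIV)"
  have "{j. C j \<noteq> UNIV} \<subseteq> {-N..N}"
    by (auto simp: C_def split: if_splits)
  then have "finite {j. C j \<noteq> UNIV}"
    using finite_subset by blast
  then have "openin full_shift_topology (PiE UNIV C)"
    unfolding full_shift_topology_def by (intro product_topology_basis) auto
  moreover have "PiE UNIV C = {x. agree N x z}"
    by (auto simp: PiE_UNIV_domain C_def agree_def Pi_iff split: if_splits)
  ultimately show ?thesis by simp
qed

lemma open_contains_cylinder:
  fixes x :: "int \<Rightarrow> 'a::finite"
  assumes "openin full_shift_topology U" "x \<in> U"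
  shows "\<exists>N::nat. {x'. agree (int N) x' x} \<subseteq> U"
proof -
  obtain C where C: "x \<in> PiE UNIV C" "finite {j. C j \<noteq> UNIV}" "PiE UNIV C \<subseteq> U"
    using product_topology_open_contains_basis[OF assms(1)[unfolded full_shift_topology_def] assms(2)]
    by auto
  obtain N where N: "\<And>j. j \<in> {j. C j \<noteq> UNIV} \<Longrightarrow> nat \<bar>j\<bar> \<le> N"
    using finite_imp_Sup_less C(2) by (metis (no_types, lifting) finite_imageI finite_nat_set_iff_bounded_le image_eqI)
  have "x' \<in> PiE UNIV C" if "agree (int N) x' x" for x'
  proof -
    have "x' j \<in> C j" for j
      using C(1) N[of j] that by (cases "C j = UNIV") (auto simp: agree_def PiE_UNIV_domain)
    then show ?thesis by (simp add: PiE_UNIV_domain)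
  qed
  then show ?thesis using C(3) by blast
qed

text \<open>The only form in which compactness is used below. A sequence without a cluster point would give a cover
  of the full shift by cylinders, each of which the sequence leaves eventually.\<close>

lemma sequence_cluster_point:
  fixes s :: "nat \<Rightarrow> int \<Rightarrow> 'a::finite"
  obtains z where "\<And>N::nat. \<exists>k\<ge>N. agree (int N) (s k) z"
proof (rule ccontr)
  assume "\<not> thesis"
  then have "\<forall>z. \<exists>N::nat. \<forall>k\<ge>N. \<not> agree (int N) (s k) z"
    using that by blast
  then obtain N :: "(int \<Rightarrow> 'a) \<Rightarrow> nat" where N: "\<And>z k. k \<ge> N z \<Longrightarrow> \<not> agree (int (N z)) (s k) z"
    by metis
  define U where "U = (\<lambda>z. {x. agree (int (N z)) x z})"
  have top: "topspace (full_shift_topology :: (int \<Rightarrow> 'a) topology) = UNIV"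
    by (simp add: full_shift_topology_def)
  have "compact_space (full_shift_topology :: (int \<Rightarrow> 'a) topology)"
    unfolding full_shift_topology_def
    by (auto simp: compact_space_product_topology compact_space_discrete_topology)
  moreover have "\<forall>V\<in>range U. openin full_shift_topology V"
    by (auto simp: U_def openin_cylinder)
  moreover have "\<Union> (range U) = UNIV"
    by (auto simp: U_def agree_def)
  ultimately obtain \<F> where "finite \<F>" "\<F> \<subseteq> range U" "\<Union>\<F> = UNIV"
    unfolding compact_space_alt top by (metis subset_UNIV top.extremum_uniqueI)
  then obtain Z where Z: "finite Z" "\<Union> (U ` Z) = UNIV"
    by (metis finite_subset_image)
  define k where "k = Max (insert 0 (N ` Z))"
  obtain z where z: "z \<in> Z" "s k \<in> U z"
    using Z(2) by blast
  then have "N z \<le> k"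
    using Z(1) by (auto simp: k_def)
  then show False
    using N[of z k] z(2) by (simp add: U_def)
qed

lemma closed_under_cylinder_limits:
  fixes X :: "(int \<Rightarrow> 'a::finite) set"
  assumes "closedin full_shift_topology X" and "\<And>N::nat. \<exists>x'\<in>X. agree (int N) x' x"
  shows "x \<in> X"
proof (rule ccontr)
  assume "x \<notin> X"
  moreover have "openin full_shift_topology (UNIV - X)"
    using assms(1) by (simp add: closedin_def full_shift_topology_def)
  ultimately obtain N :: nat where "{x'. agree (int N) x' x} \<subseteq> UNIV - X"
    using open_contains_cylinder by blast
  then show False using assms(2)[of N] by blast
qed

section \<open>Irreducible shifts of finite type\<close>

definition translate :: "int \<Rightarrow> (int \<Rightarrow> 'a) \<Rightarrow> int \<Rightarrow> 'a" where
  "translate t x = (\<lambda>j. x (j + t))"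

lemma translate_apply [simp]: "translate t x j = x (j + t)"
  by (simp add: translate_def)

lemma translate_translate [simp]: "translate s (translate t x) = translate (s + t) x"
  by (simp add: translate_def add.assoc)

lemma translate_0 [simp]: "translate 0 x = x"
  by (simp add: translate_def)

lemma translate_closed:
  assumes "shift ` X = X" "x \<in> X"
  shows "translate t x \<in> X"
proof -
  have nonneg: "translate (int n) x \<in> X" if "x \<in> X" for n x
    using that
  proof (induction n)
    case (Suc n)
    have "translate (int (Suc n)) x = shift (translate (int n) x)"
      by (simp add: translate_def shift_def fun_eq_iff algebra_simps)
    then show ?case using Suc assms(1) by (metis image_eqI)
  qed simp
  have neg: "translate (- int n) x \<in> X" if "x \<in> X" for n x
    using that
  proof (induction n)
    case (Suc n)
    then obtain x' where x': "x' \<in> X" "translate (- int n) x = shift x'"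
      using assms(1) by (metis image_iff)
    have "translate (- int (Suc n)) x j = x' j" for j
      using fun_cong[OF x'(2), of "j - 1"] by (simp add: shift_def algebra_simps)
    then show ?case using x'(1) by (metis ext)
  qed simp
  show ?thesis
    using nonneg[OF assms(2), of "nat t"] neg[OF assms(2), of "nat (- t)"] by (cases "t \<ge> 0") simp_all
qed

definition mirror :: "(int \<Rightarrow> 'a) \<Rightarrow> int \<Rightarrow> 'a" where
  "mirror x = (\<lambda>j. x (- j))"

lemma mirror_apply [simp]: "mirror x j = x (- j)"
  by (simp add: mirror_def)

lemma mirror_mirror [simp]: "mirror (mirror x) = x"
  by (simp add: mirror_def)

lemma mirror_inj: "mirror x = mirror x' \<longleftrightarrow> x = x'"
  by (metis mirror_mirror)

lemma mirror_image_iff: "x \<in> mirror ` X \<longleftrightarrow> mirror x \<in> X"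
  by (metis image_iff mirror_mirror)

lemma mirror_translate: "mirror (translate t x) = translate (- t) (mirror x)"
  by (simp add: fun_eq_iff)

definition splice :: "int \<Rightarrow> (int \<Rightarrow> 'a) \<Rightarrow> (int \<Rightarrow> 'a) \<Rightarrow> int \<Rightarrow> 'a" where
  "splice i x x' = (\<lambda>j. if j < i then x j else x' j)"

lemma splice_apply: "splice i x x' j = (if j < i then x j else x' j)"
  by (simp add: splice_def)

definition factor :: "(int \<Rightarrow> 'a) \<Rightarrow> int \<Rightarrow> nat \<Rightarrow> 'a list" where
  "factor x i n = map (\<lambda>k. x (i + int k)) [0..<n]"

lemma language_eq: "language X = {factor x i n | x i n. x \<in> X}"
  by (simp add: language_def factor_def)

lemma factor_in_language: "x \<in> X \<Longrightarrow> factor x i n \<in> language X"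
  by (auto simp: language_eq)

lemma length_factor [simp]: "length (factor x i n) = n"
  by (simp add: factor_def)

lemma factor_eq_iff: "factor x i n = factor x' i' n \<longleftrightarrow> (\<forall>j. 0 \<le> j \<and> j < int n \<longrightarrow> x (i + j) = x' (i' + j))"
  (is "?L \<longleftrightarrow> ?R")
proof
  assume L: ?L
  show ?R
  proof (intro allI impI)
    fix j assume j: "0 \<le> j \<and> j < int n"
    then have "factor x i n ! nat j = x (i + j)" "factor x' i' n ! nat j = x' (i' + j)"
      by (auto simp: factor_def)
    then show "x (i + j) = x' (i' + j)" using L by simp
  qed
qed (auto simp: factor_def)

lemma factor_append: "factor x i (m + n) = factor x i m @ factor x (i + int m) n"
  by (rule nth_equalityI) (auto simp: factor_def nth_append add.assoc)

text \<open>Shift invariance lets a word of the language be found at any prescribed coordinate.\<close>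

lemma in_language_translate:
  assumes "shift ` X = X" "w \<in> language X"
  shows "\<exists>x\<in>X. factor x i (length w) = w"
proof -
  obtain x i' n where x: "x \<in> X" "w = factor x i' n"
    using assms(2) by (auto simp: language_eq)
  then have "factor (translate (i' - i) x) i (length w) = w"
    by (simp add: factor_eq_iff algebra_simps)
  then show ?thesis using translate_closed[OF assms(1) x(1)] by blast
qed

text \<open>What the sequel needs to know about an irreducible shift of finite type, in terms of points instead of
  words: gluing at a common word of length \<open>K\<close> and joining the left half of one point to a
  translate of the right half of another.\<close>

locale irreducible_sft =
  fixes X :: "(int \<Rightarrow> 'a::finite) set" and K :: nat
  assumes limit: "(\<And>N::nat. \<exists>x'\<in>X. agree (int N) x' x) \<Longrightarrow> x \<in> X"
    and translate: "x \<in> X \<Longrightarrow> translate t x \<in> X"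
    and splice: "\<lbrakk>x \<in> X; x' \<in> X; \<And>j. i \<le> j \<Longrightarrow> j < i + int K \<Longrightarrow> x j = x' j\<rbrakk> \<Longrightarrow> splice i x x' \<in> X"
    and join: "\<lbrakk>x \<in> X; x' \<in> X\<rbrakk> \<Longrightarrow>
      \<exists>z\<in>X. \<exists>T. q < q' + T \<and> (\<forall>j\<le>q. z j = x j) \<and> (\<forall>j\<ge>q'. z (j + T) = x' j)"

text \<open>The defining condition glues words, hence all central words of the spliced sequence belong to the
  language; the sequence itself then lies in \<open>X\<close> because \<open>X\<close> is closed.\<close>

lemma finite_type_splice:
  assumes X: "shift_of_finite_type X"
  shows "\<exists>k. \<forall>x\<in>X. \<forall>x'\<in>X. \<forall>i. (\<forall>j. i \<le> j \<and> j < i + int k \<longrightarrow> x j = x' j) \<longrightarrow> splice i x x' \<in> X"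
proof -
  obtain k where k: "\<And>u w v. \<lbrakk>w \<in> language X; length w = k; u @ w \<in> language X; w @ v \<in> language X\<rbrakk>
      \<Longrightarrow> u @ w @ v \<in> language X"
    using X by (auto simp: shift_of_finite_type_def)
  have cl: "closedin full_shift_topology X" and sh: "shift ` X = X"
    using X by (auto simp: shift_of_finite_type_def shift_space_def)
  have "splice i x x' \<in> X"
    if x: "x \<in> X" and x': "x' \<in> X" and eq: "\<And>j. i \<le> j \<and> j < i + int k \<Longrightarrow> x j = x' j" for x x' i
  proof (rule closed_under_cylinder_limits[OF cl])
    fix N :: nat
    define n where "n = nat (\<bar>i\<bar> + int N)"
    define a where "a = i - int n"
    define u w v where "u = factor x a n" and "w = factor x' i k" and "v = factor x' (i + int k) (n + 1)"
    have w: "w = factor x i k"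
      unfolding w_def factor_eq_iff using eq by auto
    have "u @ w = factor x a (n + k)"
      unfolding u_def w factor_append by (simp add: a_def)
    moreover have "w @ v = factor x' i (k + (n + 1))"
      unfolding v_def w_def factor_append by (simp add: a_def)
    ultimately have "u @ w @ v \<in> language X"
      using k[of w u v] x x' factor_in_language by (metis length_factor w_def)
    moreover have "u @ w @ v = factor (splice i x x') a (n + (k + (n + 1)))"
      unfolding factor_append u_def w_def v_def
      by (auto simp: factor_eq_iff a_def splice_apply)
    ultimately obtain z where z: "z \<in> X" "factor z a (n + (k + (n + 1))) = factor (splice i x x') a (n + (k + (n + 1)))"
      using in_language_translate[OF sh, of _ a] by fastforce
    have "z j = splice i x x' j" if "\<bar>j\<bar> \<le> int N" for j
    proof -
      have "0 \<le> j - a" "j - a < int (n + (k + (n + 1)))"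
        using that by (auto simp: a_def n_def)
      then show ?thesis
        using z(2)[unfolded factor_eq_iff, rule_format, of "j - a"] by simp
    qed
    then show "\<exists>x''\<in>X. agree (int N) x'' (splice i x x')"
      using z(1) by (auto simp: agree_def)
  qed
  then show ?thesis by blast
qed

lemma irreducible_sftI:
  assumes irr: "irreducible_shift X"
    and sp: "\<And>x x' i. \<lbrakk>x \<in> X; x' \<in> X; \<And>j. i \<le> j \<Longrightarrow> j < i + int K \<Longrightarrow> x j = x' j\<rbrakk> \<Longrightarrow> splice i x x' \<in> X"
  shows "irreducible_sft X K"
proof
  have cl: "closedin full_shift_topology X" and sh: "shift ` X = X"
    using irr by (auto simp: irreducible_shift_def shift_space_def)
  show "x \<in> X" if "\<And>N::nat. \<exists>x'\<in>X. agree (int N) x' x" for x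
    using closed_under_cylinder_limits[OF cl] that by blast
  show tr: "translate t x \<in> X" if "x \<in> X" for t x
    using translate_closed[OF sh that] .
  show "splice i x x' \<in> X" if "x \<in> X" "x' \<in> X" "\<And>j. i \<le> j \<Longrightarrow> j < i + int K \<Longrightarrow> x j = x' j" for i x x'
    using sp that .
  fix x x' q q' assume x: "x \<in> X" and x': "x' \<in> X"
  define u v where "u = factor x (q + 1 - int K) K" and "v = factor x' q' K"
  obtain w where w: "u @ w @ v \<in> language X"
    using irr x x' factor_in_language unfolding irreducible_shift_def u_def v_def by blast
  \<comment> \<open>The gap between the two halves has the length of the connecting word, whence the shift T.\<close>
  define l where "l = length w"
  define T where "T = q + 1 + int l - q'"
  have len: "length (u @ w @ v) = K + (l + K)"
    by (simp add: u_def v_def l_def)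
  obtain z where z: "z \<in> X" "factor z (q + 1 - int K) (K + (l + K)) = u @ w @ v"
    using in_language_translate[OF sh w, of "q + 1 - int K"] unfolding len by blast
  have "factor z (q + 1 - int K) K = u" "factor z (q + 1 + int l) K = v"
    using z(2) unfolding factor_append by (auto simp: l_def u_def v_def add.assoc)
  note uv = this[unfolded u_def v_def factor_eq_iff, rule_format]
  have zx: "z j = x j" if "q + 1 - int K \<le> j" "j \<le> q" for j
    using uv(1)[of "j - (q + 1 - int K)"] that by simp
  have zx': "z (j + T) = x' j" if "q' \<le> j" "j < q' + int K" for j
    using uv(2)[of "j - q'"] that by (simp add: T_def algebra_simps)
  define z1 where "z1 = splice (q + 1 - int K) x z"
  have z1: "z1 \<in> X"
    unfolding z1_def using zx by (intro sp x z(1)) auto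
  have eq2: "z1 j = x' (j - T)" if "q' + T \<le> j" "j < q' + T + int K" for j
    using zx'[of "j - T"] that by (simp add: z1_def splice_apply T_def)
  define z2 where "z2 = splice (q' + T) z1 (translate (- T) x')"
  have "z2 \<in> X"
    unfolding z2_def using eq2 by (intro sp z1 tr x') auto
  moreover have "\<forall>j\<le>q. z2 j = x j"
    using zx by (auto simp: z2_def z1_def splice_apply T_def)
  moreover have "\<forall>j\<ge>q'. z2 (j + T) = x' j"
    by (auto simp: z2_def splice_apply)
  ultimately show "\<exists>z\<in>X. \<exists>T. q < q' + T \<and> (\<forall>j\<le>q. z j = x j) \<and> (\<forall>j\<ge>q'. z (j + T) = x' j)"
    by (intro bexI[of _ z2] exI[of _ T]) (auto simp: T_def)
qed

lemma factor_code_translate: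
  assumes sh: "shift ` X = X" and fc: "factor_code X Y \<pi>" and "x \<in> X"
  shows "\<pi> (translate t x) = translate t (\<pi> x)"
proof -
  have shift_eq: "shift = translate 1"
    by (simp add: translate_def shift_def fun_eq_iff)
  have one: "\<pi> (translate 1 x) = translate 1 (\<pi> x)" if "x \<in> X" for x
    using fc that by (simp add: factor_code_def shift_eq)
  have tr: "translate t x \<in> X" if "x \<in> X" for t x
    using translate_closed[OF sh that] .
  have nonneg: "\<pi> (translate (int n) x) = translate (int n) (\<pi> x)" if "x \<in> X" for n x
  proof (induction n)
    case (Suc n)
    then show ?case
      using one[OF tr[OF that, of "int n"]] by (metis of_nat_Suc translate_translate)
  qed simp
  have neg: "\<pi> (translate (- int n) x) = translate (- int n) (\<pi> x)" if "x \<in> X" for n x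
    using nonneg[OF tr[OF that, of "- int n"], of n] by (metis add.right_inverse add.left_inverse translate_0 translate_translate)
  show ?thesis
    using nonneg[OF assms(3), of "nat t"] neg[OF assms(3), of "nat (- t)"] by (cases "t \<ge> 0") simp_all
qed

text \<open>The Curtis--Hedlund--Lyndon theorem. Two sequences that agree on larger and larger windows but have
  different images at \<open>0\<close> would cluster at a point where \<open>\<pi>\<close> is discontinuous.\<close>

lemma factor_code_local:
  assumes cl: "closedin full_shift_topology X" and sh: "shift ` X = X" and fc: "factor_code X Y \<pi>"
  shows "\<exists>r::nat. \<forall>x\<in>X. \<forall>x'\<in>X. \<forall>j. (\<forall>k. \<bar>k - j\<bar> \<le> int r \<longrightarrow> x k = x' k) \<longrightarrow> \<pi> x j = \<pi> x' j"
proof -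
  have tr: "translate t x \<in> X" if "x \<in> X" for t x
    using translate_closed[OF sh that] .
  have com: "\<pi> (translate t x) = translate t (\<pi> x)" if "x \<in> X" for t x
    using factor_code_translate[OF sh fc that] .
  have "\<exists>r::nat. \<forall>x\<in>X. \<forall>x'\<in>X. agree (int r) x x' \<longrightarrow> \<pi> x 0 = \<pi> x' 0"
  proof (rule ccontr)
    assume "\<not> ?thesis"
    then have "\<forall>k::nat. \<exists>x x'. x \<in> X \<and> x' \<in> X \<and> agree (int k) x x' \<and> \<pi> x 0 \<noteq> \<pi> x' 0"
      by blast
    then obtain s s' where s: "\<And>k. s k \<in> X" "\<And>k. s' k \<in> X"
      "\<And>k. agree (int k) (s k) (s' k)" "\<And>k. \<pi> (s k) 0 \<noteq> \<pi> (s' k) 0"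
      by metis
    obtain z where z: "\<And>N::nat. \<exists>k\<ge>N. agree (int N) (s k) z"
      using sequence_cluster_point[of s] by blast
    have zX: "z \<in> X"
      using closed_under_cylinder_limits[OF cl] z s(1) by metis
    define V where "V = {y. agree 0 y (\<lambda>_. \<pi> z 0)}"
    have V: "y \<in> V \<longleftrightarrow> y 0 = \<pi> z 0" for y
      by (simp add: V_def agree_def)
    have "openin (subtopology full_shift_topology Y) (V \<inter> Y)"
      using openin_cylinder unfolding V_def by (auto simp: openin_subtopology)
    then have "openin (subtopology full_shift_topology X)
        {x \<in> topspace (subtopology full_shift_topology X). \<pi> x \<in> V \<inter> Y}"
      using fc openin_continuous_map_preimage unfolding factor_code_def by blast
    then obtain U where U: "openin full_shift_topology U" "{x \<in> X. \<pi> x \<in> V \<inter> Y} = U \<inter> X"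
      by (auto simp: openin_subtopology full_shift_topology_def)
    have img: "\<pi> ` X = Y"
      using fc by (simp add: factor_code_def)
    then have "z \<in> U"
      using U(2) zX V by blast
    then obtain N :: nat where N: "{x. agree (int N) x z} \<subseteq> U"
      using open_contains_cylinder[OF U(1)] by blast
    obtain k where k: "k \<ge> N" "agree (int N) (s k) z"
      using z by blast
    then have "agree (int N) (s' k) z"
      using s(3)[of k] unfolding agree_def by force
    then have "\<pi> (s k) \<in> V" "\<pi> (s' k) \<in> V"
      using N U(2) k(2) s(1,2) by blast+
    then show False
      using s(4)[of k] V by simp
  qed
  then obtain r :: nat where r: "\<And>x x'. \<lbrakk>x \<in> X; x' \<in> X; agree (int r) x x'\<rbrakk> \<Longrightarrow> \<pi> x 0 = \<pi> x' 0"
    by blast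
  have "\<pi> x j = \<pi> x' j" if "x \<in> X" "x' \<in> X" "\<forall>k. \<bar>k - j\<bar> \<le> int r \<longrightarrow> x k = x' k" for x x' j
  proof -
    have "agree (int r) (translate j x) (translate j x')"
      using that(3) by (simp add: agree_def)
    then have "\<pi> (translate j x) 0 = \<pi> (translate j x') 0"
      using r tr that(1,2) by blast
    then show ?thesis
      using com that(1,2) by simp
  qed
  then show ?thesis by blast
qed

context irreducible_sft
begin

text \<open>A loop that starts and ends with the same word can be traversed any number of times; a cluster point of
  these finite repetitions shows the window periodically to the right.\<close>

lemma recurrent_point:
  assumes x: "x \<in> X" and ab: "a \<le> b"
  obtains z T where "z \<in> X" "T > 0" "\<And>i j. \<lbrakk>a \<le> j; j \<le> b\<rbrakk> \<Longrightarrow> z (j + int i * T) = x j"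
proof -
  \<comment> \<open>Keeping x up to b + K makes every copy show x on the K coordinates from a on, where it is spliced.\<close>
  obtain u T where u: "u \<in> X" "b + int K < a + T" "\<And>j. j \<le> b + int K \<Longrightarrow> u j = x j"
    "\<And>j. a \<le> j \<Longrightarrow> u (j + T) = x j"
    using join[OF x x, of "b + int K" a] by metis
  define s where "s = rec_nat u (\<lambda>_ v. splice (a + T) u (translate (- T) v))"
  have s: "s 0 = u" "s (Suc k) = splice (a + T) u (translate (- T) (s k))" for k
    by (auto simp: s_def)
  have s_start: "s k j = x j" if "a \<le> j" "j \<le> b + int K" for k j
    using that u(2,3) by (cases k) (auto simp: s splice_apply)
  have s_in: "s k \<in> X" for k
  proof (induction k)
    case (Suc k)
    have "u j = translate (- T) (s k) j" if "a + T \<le> j" "j < a + T + int K" for j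
      using s_start[of "j - T" k] u(4)[of "j - T"] that ab by simp
    then show ?case
      unfolding s using Suc u(1) by (intro splice translate) auto
  qed (simp add: s u)
  have s_copies: "s k (j + int i * T) = x j" if "i \<le> k" "a \<le> j" "j \<le> b" for i j k
    using that(1)
  proof (induction k arbitrary: i)
    case 0
    then show ?case using s_start[of j 0] that by simp
  next
    case (Suc k)
    show ?case
    proof (cases i)
      case 0
      then show ?thesis using s_start[of j "Suc k"] that by simp
    next
      case (Suc i')
      have eq: "j + int i * T = (j + int i' * T) + T"
        using Suc by (simp add: algebra_simps)
      have "0 \<le> T" using u(2) ab by simp
      then have "a \<le> j + int i' * T" using that(2) by (simp add: add_increasing2)
      then have "s (Suc k) (j + int i * T) = s k (j + int i' * T)"
        unfolding eq s by (simp add: splice_apply)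
      then show ?thesis using Suc.IH[of i'] Suc.prems Suc by simp
    qed
  qed
  obtain z where z: "\<And>N::nat. \<exists>k\<ge>N. agree (int N) (s k) z"
    using sequence_cluster_point[of s] by blast
  have "z \<in> X" using limit z s_in by metis
  moreover have "T > 0" using u(2) ab by simp
  moreover have "z (j + int i * T) = x j" if "a \<le> j" "j \<le> b" for i j
  proof -
    obtain k where "k \<ge> nat \<bar>j + int i * T\<bar> + i" "agree (int (nat \<bar>j + int i * T\<bar> + i)) (s k) z"
      using z by blast
    then show ?thesis using s_copies[of i k j] that agreeD[of _ "s k" z "j + int i * T"] by simp
  qed
  ultimately show ?thesis using that by blast
qed

text \<open>Reflection exchanges left and right, so that the statement about left class-closing below follows
  from the one about right class-closing.\<close>

lemma mirror_irreducible_sft: "irreducible_sft (mirror ` X) K"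
proof (unfold_locales, unfold mirror_image_iff)
  fix x assume *: "\<And>N::nat. \<exists>x'\<in>mirror ` X. agree (int N) x' x"
  show "mirror x \<in> X"
  proof (rule limit)
    fix N :: nat
    obtain x' where "x' \<in> X" "agree (int N) (mirror x') x" using *[of N] by auto
    then show "\<exists>x'\<in>X. agree (int N) x' (mirror x)"
      unfolding agree_def by (metis abs_minus_cancel minus_minus mirror_apply)
  qed
next
  fix x t assume "mirror x \<in> X"
  then show "mirror (translate t x) \<in> X" unfolding mirror_translate by (rule translate)
next
  fix x x' i assume x: "mirror x \<in> X" "mirror x' \<in> X"
    and eq: "\<And>j. i \<le> j \<Longrightarrow> j < i + int K \<Longrightarrow> x j = x' j"
  \<comment> \<open>The common word occupies i, ..., i + K - 1, which reflects to 1 - i - K, ..., - i.\<close>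
  have "splice (1 - i - int K) (mirror x') (mirror x) \<in> X"
    using eq by (intro splice x) auto
  moreover have "splice (1 - i - int K) (mirror x') (mirror x) = mirror (splice i x x')"
    using eq by (auto simp: fun_eq_iff splice_apply)
  ultimately show "mirror (splice i x x') \<in> X" by simp
next
  fix x x' q q' assume x: "mirror x \<in> X" "mirror x' \<in> X"
  obtain z T where z: "z \<in> X" "- q' < - q + T" "\<And>j. j \<le> - q' \<Longrightarrow> z j = x' (- j)"
    "\<And>j. j \<ge> - q \<Longrightarrow> z (j + T) = x (- j)"
    using join[OF x(2,1), of "- q'" "- q"] unfolding mirror_apply by metis
  have "mirror (translate T z) \<in> mirror ` X"
    using translate[OF z(1)] by blast
  moreover have "mirror (translate T z) j = x j" if "j \<le> q" for j
    using z(4)[of "- j"] that by simp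
  moreover have "mirror (translate T z) (j + T) = x' j" if "j \<ge> q'" for j
    using z(3)[of "- j"] that by simp
  ultimately show "\<exists>z\<in>mirror ` X. \<exists>T. q < q' + T \<and> (\<forall>j\<le>q. z j = x j) \<and> (\<forall>j\<ge>q'. z (j + T) = x' j)"
    using z(2) by (intro bexI[of _ "mirror (translate T z)"] exI[of _ T]) auto
qed

end

section \<open>Transitive semigroups of relations\<close>

text \<open>The powers of a relation on a finite set repeat, and a repetition with period \<open>p\<close> from exponent \<open>i\<close>
  on makes the power with exponent \<open>i * p\<close> idempotent.\<close>

lemma finite_relation_idempotent_power:
  assumes "finite M" "B \<subseteq> M \<times> M"
  shows "\<exists>k>0. B ^^ k O B ^^ k = B ^^ k"
proof -
  have sub: "B ^^ Suc n \<subseteq> M \<times> M" for n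
    using assms(2) by (induction n) auto
  have "range (\<lambda>n. B ^^ Suc n) \<subseteq> Pow (M \<times> M)"
    using sub by blast
  then have "finite (range (\<lambda>n. B ^^ Suc n))"
    using assms(1) by (meson finite_Pow_iff finite_SigmaI finite_subset)
  then have "\<not> inj (\<lambda>n. B ^^ Suc n)"
    using finite_imageD by blast
  then obtain i' j' where "i' \<noteq> j'" "B ^^ Suc i' = B ^^ Suc j'"
    unfolding inj_def by blast
  then obtain i p where ip: "i > 0" "p > 0" "B ^^ (i + p) = B ^^ i"
    by (cases "i' < j'")
       (metis less_imp_add_positive add_Suc zero_less_Suc, metis linorder_neqE_nat less_imp_add_positive add_Suc zero_less_Suc)
  have step: "B ^^ (k + p) = B ^^ k" if "k \<ge> i" for k
  proof -
    have "B ^^ (k + p) = B ^^ (i + p) O B ^^ (k - i)"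
      using that by (metis add.commute add.left_commute le_add_diff_inverse relpow_add)
    also have "\<dots> = B ^^ k"
      using that by (metis ip(3) le_add_diff_inverse relpow_add)
    finally show ?thesis .
  qed
  have steps: "B ^^ (k + m * p) = B ^^ k" if "k \<ge> i" for k m
  proof (induction m)
    case (Suc m)
    then show ?case
      using step[of "k + m * p"] that by (simp add: algebra_simps)
  qed simp
  have "B ^^ (i * p) O B ^^ (i * p) = B ^^ (i * p + i * p)"
    by (simp add: relpow_add)
  also have "\<dots> = B ^^ (i * p)"
    using ip by (intro steps) simp
  finally show ?thesis
    using ip by (intro exI[of _ "i * p"]) simp
qed

text \<open>An abstract form of the connection relations between occurrences of a minimal routing. A state that
  all two-step connections could avoid would contradict the least size of \<open>M\<close>.\<close>

locale minimal_transitive_relations =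
  fixes M :: "'s set" and \<B> :: "('s \<times> 's) set set"
  assumes fin: "finite M"
    and on: "B \<in> \<B> \<Longrightarrow> B \<subseteq> M \<times> M"
    and comp: "\<lbrakk>B \<in> \<B>; B' \<in> \<B>\<rbrakk> \<Longrightarrow> B O B' \<in> \<B>"
    and connect: "\<lbrakk>c \<in> M; f \<in> M\<rbrakk> \<Longrightarrow> \<exists>B\<in>\<B>. (c, f) \<in> B"
    and minimal: "\<lbrakk>B \<in> \<B>; N \<subseteq> M; \<And>a b. (a, b) \<in> B O B \<Longrightarrow> \<exists>m\<in>N. (a, m) \<in> B \<and> (m, b) \<in> B\<rbrakk> \<Longrightarrow> N = M"
begin

lemma power_mem: "B \<in> \<B> \<Longrightarrow> k > 0 \<Longrightarrow> B ^^ k \<in> \<B>"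
proof (induction k)
  case (Suc k)
  then show ?case using comp by (cases "k = 0") auto
qed simp

text \<open>Otherwise \<open>c\<close> can be bypassed: a three-step connection has two intermediate states, and they are not
  both \<open>c\<close>, since \<open>c\<close> does not follow itself.\<close>

lemma idempotent_refl:
  assumes E: "E \<in> \<B>" "E O E = E" and c: "c \<in> M"
  shows "(c, c) \<in> E"
proof (rule ccontr)
  assume n: "(c, c) \<notin> E"
  have "M - {c} = M"
  proof (rule minimal[OF E(1)])
    fix a b assume "(a, b) \<in> E O E"
    then have "(a, b) \<in> E O E O E" using E(2) by (simp add: O_assoc)
    then obtain m m' where m: "(a, m) \<in> E" "(m, m') \<in> E" "(m', b) \<in> E" by blast
    then have "(m, b) \<in> E" "(a, m') \<in> E" using E(2) by blast+
    then show "\<exists>m\<in>M - {c}. (a, m) \<in> E \<and> (m, b) \<in> E"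
      using m n on[OF E(1)] by blast
  qed auto
  then show False using c by blast
qed

text \<open>Of two mutually reachable states, each can take over all connections of the other.\<close>

lemma idempotent_antisym:
  assumes E: "E \<in> \<B>" "E O E = E" and c: "(c, f) \<in> E" "(f, c) \<in> E"
  shows "c = f"
proof (rule ccontr)
  assume n: "c \<noteq> f"
  have "M - {c} = M"
  proof (rule minimal[OF E(1)])
    fix a b assume "(a, b) \<in> E O E"
    then obtain m where m: "(a, m) \<in> E" "(m, b) \<in> E" by blast
    show "\<exists>m\<in>M - {c}. (a, m) \<in> E \<and> (m, b) \<in> E"
    proof (cases "m = c")
      case True
      then have "(a, f) \<in> E" "(f, b) \<in> E" using m c E(2) by blast+
      then show ?thesis using n on[OF E(1)] by blast
    qed (use m on[OF E(1)] in blast)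
  qed auto
  then show False using c on[OF E(1)] by blast
qed

text \<open>A return from \<open>f\<close> to \<open>c\<close>, framed by \<open>E\<close>, has an idempotent power that still contains \<open>(c, f)\<close>
  because \<open>E\<close> acts on it as a left identity, and that contains \<open>(f, c)\<close> because it can wait at \<open>f\<close>.
  This contradicts antisymmetry.\<close>

lemma idempotent_Id:
  assumes E: "E \<in> \<B>" "E O E = E" and cf: "(c, f) \<in> E"
  shows "c = f"
proof -
  have M: "c \<in> M" "f \<in> M" using on[OF E(1)] cf by auto
  obtain B where B: "B \<in> \<B>" "(f, c) \<in> B" using connect M by blast
  define P where "P = E O (B O E)"
  have P: "P \<in> \<B>" using E B comp by (simp add: P_def)
  obtain k where k: "k > 0" "P ^^ k O P ^^ k = P ^^ k"
    using finite_relation_idempotent_power[OF fin on[OF P]] by blast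
  define E' where "E' = P ^^ k"
  have E': "E' \<in> \<B>" "E' O E' = E'" using power_mem[OF P k(1)] k(2) by (auto simp: E'_def)
  have "E O P = P" using E(2) by (simp add: P_def O_assoc[symmetric])
  moreover obtain k' where k': "k = Suc k'" using k(1) gr0_implies_Suc by blast
  ultimately have "E O E' = E'"
    by (metis E'_def O_assoc relpow.simps(2) relpow_commute)
  then have 1: "(c, f) \<in> E'"
    using cf idempotent_refl[OF E' M(2)] by blast
  have P1: "(f, f) \<in> P" "(f, c) \<in> P"
    using cf B(2) idempotent_refl[OF E M(1)] idempotent_refl[OF E M(2)] by (auto simp: P_def)
  have "(f, f) \<in> P ^^ n" for n
    using P1(1) by (induction n) auto
  then have "(f, c) \<in> E'"
    using P1(2) by (auto simp: E'_def k')
  then show "c = f" using idempotent_antisym[OF E' 1] by blast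
qed

lemma power_Id: "B \<in> \<B> \<Longrightarrow> \<exists>k. B ^^ Suc k = Id_on M"
proof -
  assume B: "B \<in> \<B>"
  obtain k where k: "k > 0" "B ^^ k O B ^^ k = B ^^ k"
    using finite_relation_idempotent_power[OF fin on[OF B]] by blast
  have "B ^^ k \<in> \<B>" using power_mem[OF B k(1)] .
  then have "B ^^ k = Id_on M"
    using idempotent_Id[OF _ k(2)] idempotent_refl[OF _ k(2)] on by fastforce
  then show ?thesis using k(1) gr0_implies_Suc by blast
qed

lemma functional:
  assumes B: "B \<in> \<B>" and cf: "(c, f) \<in> B" "(c, g) \<in> B"
  shows "f = g"
proof -
  obtain k where k: "B ^^ Suc k = Id_on M" using power_Id[OF B] by blast
  have "f \<in> M" using on[OF B] cf by auto
  then have "(f, f) \<in> B ^^ k O B" using k by auto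
  then obtain h where h: "(f, h) \<in> B ^^ k" "(h, f) \<in> B" by blast
  have "B O B ^^ k = Id_on M" using k relpow_commute by (metis relpow.simps(2))
  then have "h = c" using cf(1) h(1) by blast
  then have "(f, g) \<in> B ^^ k O B" using h(1) cf(2) by blast
  then show ?thesis using k by auto
qed

lemma injective:
  assumes B: "B \<in> \<B>" and cf: "(f, c) \<in> B" "(g, c) \<in> B"
  shows "f = g"
proof -
  obtain k where k: "B ^^ Suc k = Id_on M" using power_Id[OF B] by blast
  have comm: "B O B ^^ k = Id_on M" using k relpow_commute by (metis relpow.simps(2))
  have "f \<in> M" using on[OF B] cf by auto
  then have "(f, f) \<in> B O B ^^ k" using comm by auto
  then obtain h where h: "(f, h) \<in> B" "(h, f) \<in> B ^^ k" by blast
  have "h = c" using functional[OF B cf(1) h(1)] by simp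
  then have "(g, f) \<in> B O B ^^ k" using h cf by blast
  then show ?thesis using comm by auto
qed

end

section \<open>Fibres of a factor code\<close>

text \<open>The bound on \<open>K\<close> ensures that at each coordinate the image of a splice is determined by one of the
  two points alone.\<close>

locale class_code = dom: irreducible_sft X K + cod: irreducible_sft Y K
  for X :: "(int \<Rightarrow> 'a::finite) set" and Y :: "(int \<Rightarrow> 'b::finite) set" and K :: nat +
  fixes \<pi> :: "(int \<Rightarrow> 'a) \<Rightarrow> (int \<Rightarrow> 'b)" and r :: nat
  assumes image: "\<pi> ` X = Y"
    and translate: "x \<in> X \<Longrightarrow> \<pi> (translate t x) = translate t (\<pi> x)"
    and local_rule: "\<lbrakk>x \<in> X; x' \<in> X; \<And>k. \<bar>k - j\<bar> \<le> int r \<Longrightarrow> x k = x' k\<rbrakk> \<Longrightarrow> \<pi> x j = \<pi> x' j"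
    and radius: "2 * r + 1 \<le> K"
begin

definition fibre :: "(int \<Rightarrow> 'b) \<Rightarrow> (int \<Rightarrow> 'a) set" where
  "fibre y = {x \<in> X. \<pi> x = y}"

lemma fibreI: "x \<in> X \<Longrightarrow> \<pi> x = y \<Longrightarrow> x \<in> fibre y"
  and fibreD: "x \<in> fibre y \<Longrightarrow> x \<in> X" "x \<in> fibre y \<Longrightarrow> \<pi> x = y"
  by (auto simp: fibre_def)

lemma fibre_translate: "x \<in> fibre y \<Longrightarrow> translate t x \<in> fibre (translate t y)"
  using dom.translate translate by (auto simp: fibre_def)

abbreviation state :: "(int \<Rightarrow> 'a) \<Rightarrow> int \<Rightarrow> 'a list" where
  "state x n \<equiv> factor x n K"

lemma state_eqI: "(\<And>j. n \<le> j \<Longrightarrow> j < n + int K \<Longrightarrow> x j = x' j) \<Longrightarrow> state x n = state x' n"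
  by (simp add: factor_eq_iff)

lemma state_eqD: "state x n = state x' n \<Longrightarrow> n \<le> j \<Longrightarrow> j < n + int K \<Longrightarrow> x j = x' j"
  by (auto simp: factor_eq_iff dest: spec[of _ "j - n"])

lemma state_translate [simp]: "state (translate t x) n = state x (n + t)"
  by (simp add: factor_eq_iff algebra_simps)

lemma finite_states: "finite (range (\<lambda>(x, n). state x n))"
proof (rule finite_subset)
  show "range (\<lambda>(x, n). state x n) \<subseteq> {w. set w \<subseteq> UNIV \<and> length w = K}" by auto
  show "finite {w :: 'a list. set w \<subseteq> UNIV \<and> length w = K}"
    using finite_lists_length_eq[of "UNIV :: 'a set" K] by simp
qed

lemma splice_left: "state x i = state x' i \<Longrightarrow> j < i + int K \<Longrightarrow> splice i x x' j = x j"
  using state_eqD[of x i x' j] by (auto simp: splice_apply)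

lemma splice_right: "i \<le> j \<Longrightarrow> splice i x x' j = x' j"
  by (auto simp: splice_apply)

lemma state_splice:
  "state x i = state x' i \<Longrightarrow> state (splice i x x') n = (if n \<le> i then state x n else state x' n)"
  by (auto intro!: state_eqI simp: splice_left splice_right)

text \<open>The switch from \<open>\<pi> x\<close> to \<open>\<pi> x'\<close> happens at \<open>i + r\<close>: to its left all coordinates read by \<open>\<pi>\<close> are
  smaller than \<open>i + K\<close>, where the splice still shows \<open>x\<close>, and from it on they are at least \<open>i\<close>.\<close>

lemma splice_fibre:
  assumes "x \<in> X" "x' \<in> X" "state x i = state x' i"
    and "\<And>j. j < i + int r \<Longrightarrow> \<pi> x j = y j" "\<And>j. j \<ge> i + int r \<Longrightarrow> \<pi> x' j = y j"
  shows "splice i x x' \<in> fibre y"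
proof (rule fibreI)
  show X: "splice i x x' \<in> X"
    using assms(1-3) by (intro dom.splice) (auto dest: state_eqD)
  show "\<pi> (splice i x x') = y"
  proof
    fix j
    show "\<pi> (splice i x x') j = y j"
    proof (cases "j < i + int r")
      case True
      then have "\<pi> (splice i x x') j = \<pi> x j"
        using assms(3) radius by (intro local_rule X assms(1) splice_left) auto
      then show ?thesis using assms(4) True by simp
    next
      case False
      then have "\<pi> (splice i x x') j = \<pi> x' j"
        by (intro local_rule X assms(2) splice_right) auto
      then show ?thesis using assms(5) False by simp
    qed
  qed
qed

lemma splice_same_fibre:
  "\<lbrakk>x \<in> fibre y; x' \<in> fibre y; state x i = state x' i\<rbrakk> \<Longrightarrow> splice i x x' \<in> fibre y"
  by (intro splice_fibre) (auto simp: fibre_def)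

lemma limit_fibre:
  assumes "\<And>N::nat. \<exists>x'\<in>X. agree (int N) x' x \<and> agree (int N) (\<pi> x') y"
  shows "x \<in> fibre y"
proof (rule fibreI)
  show X: "x \<in> X" using assms dom.limit by meson
  show "\<pi> x = y"
  proof
    fix j
    define N where "N = nat \<bar>j\<bar> + r"
    obtain x' where x': "x' \<in> X" "agree (int N) x' x" "agree (int N) (\<pi> x') y"
      using assms by blast
    have "\<pi> x' j = \<pi> x j"
      by (intro local_rule x' X agreeD[OF x'(2)]) (auto simp: N_def)
    then show "\<pi> x j = y j"
      using agreeD[OF x'(3), of j] by (simp add: N_def)
  qed
qed

lemma fibre_cluster_point:
  assumes "\<And>k. s k \<in> X" "\<And>k. agree (int k) (\<pi> (s k)) y"
  obtains x where "x \<in> fibre y" "\<And>N::nat. \<exists>k\<ge>N. agree (int N) (s k) x"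
proof -
  obtain x where x: "\<And>N::nat. \<exists>k\<ge>N. agree (int N) (s k) x"
    using sequence_cluster_point[of s] by blast
  have "x \<in> fibre y"
  proof (rule limit_fibre)
    fix N :: nat
    obtain k where "k \<ge> N" "agree (int N) (s k) x" using x by blast
    then show "\<exists>x'\<in>X. agree (int N) x' x \<and> agree (int N) (\<pi> x') y"
      using assms[of k] by (intro bexI[of _ "s k"]) (auto simp: agree_def)
  qed
  then show ?thesis using that x by blast
qed

section \<open>Routings of least size\<close>

text \<open>A point that lies over \<open>y\<close> on the window stands for a preimage of the word there: every word of the
  language extends to a point.\<close>

definition routing :: "(int \<Rightarrow> 'b) \<Rightarrow> int \<Rightarrow> int \<Rightarrow> int \<Rightarrow> 'a list set \<Rightarrow> bool" where
  "routing y a b n M \<longleftrightarrow> a \<le> n \<and> n + int K \<le> b \<and> finite M \<and>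
     (\<forall>x\<in>X. (\<forall>j. a \<le> j \<and> j \<le> b \<longrightarrow> \<pi> x j = y j) \<longrightarrow>
        (\<exists>z\<in>fibre (\<pi> x). (\<forall>j. j \<le> a \<or> b \<le> j \<longrightarrow> z j = x j) \<and> state z n \<in> M))"

lemma routingE:
  assumes "routing y a b n M" "x \<in> X" "\<And>j. a \<le> j \<Longrightarrow> j \<le> b \<Longrightarrow> \<pi> x j = y j"
  obtains z where "z \<in> fibre (\<pi> x)" "\<And>j. j \<le> a \<or> b \<le> j \<Longrightarrow> z j = x j" "state z n \<in> M"
  using assms unfolding routing_def by blast

lemma routing_cong:
  assumes "routing y a b n M" "\<And>j. a \<le> j \<Longrightarrow> j \<le> b \<Longrightarrow> y' j = y j"
  shows "routing y' a b n M"
  using assms unfolding routing_def by simp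

lemma routing_translate:
  assumes "routing y a b n M"
  shows "routing (translate t y) (a - t) (b - t) (n - t) M"
  unfolding routing_def
proof (intro conjI ballI impI)
  show "a - t \<le> n - t" "n - t + int K \<le> b - t" "finite M"
    using assms by (auto simp: routing_def)
  fix x assume x: "x \<in> X" and eq: "\<forall>j. a - t \<le> j \<and> j \<le> b - t \<longrightarrow> \<pi> x j = translate t y j"
  have "\<pi> (translate (- t) x) j = y j" if "a \<le> j" "j \<le> b" for j
    using eq[rule_format, of "j - t"] that x by (simp add: translate)
  then obtain z where z: "z \<in> fibre (\<pi> (translate (- t) x))"
    "\<And>j. j \<le> a \<or> b \<le> j \<Longrightarrow> z j = translate (- t) x j" "state z n \<in> M"
    using routingE[OF assms, of "translate (- t) x"] dom.translate[OF x] by metis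
  have "translate t z \<in> fibre (\<pi> x)"
    using fibre_translate[OF z(1), of t] x by (simp add: translate)
  moreover have "translate t z j = x j" if "j \<le> a - t \<or> b - t \<le> j" for j
    using z(2)[of "j + t"] that by auto
  moreover have "state (translate t z) (n - t) \<in> M"
    using z(3) by simp
  ultimately show "\<exists>z\<in>fibre (\<pi> x). (\<forall>j. j \<le> a - t \<or> b - t \<le> j \<longrightarrow> z j = x j) \<and> state z (n - t) \<in> M"
    by blast
qed

lemma routing_all_states: "routing y n (n + int K) n (range (\<lambda>(x, n). state x n))"
  unfolding routing_def using finite_states by (auto intro!: bexI fibreI)

text \<open>For nonempty \<open>Y\<close> this number turns out to be the class degree of the code, see
  \<open>constant_iff_depth\<close>.\<close>

definition depth :: nat where
  "depth = (LEAST d. \<exists>y\<in>Y. \<exists>a b n M. routing y a b n M \<and> card M = d)"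

definition minimal_routing :: "(int \<Rightarrow> 'b) \<Rightarrow> int \<Rightarrow> int \<Rightarrow> int \<Rightarrow> 'a list set \<Rightarrow> bool" where
  "minimal_routing y a b n M \<longleftrightarrow> y \<in> Y \<and> routing y a b n M \<and> card M = depth"

lemma minimal_routingD:
  assumes "minimal_routing y a b n M"
  shows "y \<in> Y" "routing y a b n M" "card M = depth" "a \<le> n" "n + int K \<le> b" "finite M"
  using assms by (auto simp: minimal_routing_def routing_def)

lemma depth_le: "y \<in> Y \<Longrightarrow> routing y a b n M \<Longrightarrow> depth \<le> card M"
  unfolding depth_def by (rule Least_le) blast

lemma minimal_routing_exists:
  assumes "Y \<noteq> {}"
  obtains y a b n M where "minimal_routing y a b n M"
proof -
  have "\<exists>d. \<exists>y\<in>Y. \<exists>a b n M. routing y a b n M \<and> card M = d"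
    using assms routing_all_states by blast
  from LeastI_ex[OF this] show ?thesis
    using that unfolding depth_def[symmetric] minimal_routing_def by blast
qed

lemma minimal_routing_cong:
  "\<lbrakk>minimal_routing y a b n M; y' \<in> Y; \<And>j. a \<le> j \<Longrightarrow> j \<le> b \<Longrightarrow> y' j = y j\<rbrakk> \<Longrightarrow> minimal_routing y' a b n M"
  using routing_cong unfolding minimal_routing_def by blast

lemma minimal_routing_translate:
  "minimal_routing y a b n M \<Longrightarrow> minimal_routing (translate t y) (a - t) (b - t) (n - t) M"
  using routing_translate cod.translate unfolding minimal_routing_def by blast

text \<open>A state that occurs in no point of the fibre does not occur, by compactness, in any preimage of
  some larger window either; it could then be removed from \<open>M\<close>.\<close>

lemma minimal_routing_state_realized:
  assumes mr: "minimal_routing y a b n M" and c: "c \<in> M"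
  obtains z where "z \<in> fibre y" "state z n = c"
proof (rule ccontr)
  assume no: "\<not> thesis"
  note mrD = minimal_routingD[OF mr]
  define m where "m = nat (\<bar>a\<bar> + \<bar>b\<bar>)"
  have "\<exists>x\<in>X. agree (int k) (\<pi> x) y \<and> state x n = c" for k
  proof (rule ccontr)
    assume none: "\<not> ?thesis"
    define l where "l = int (max k m)"
    have l: "-l \<le> a" "b \<le> l" "int k \<le> l" by (auto simp: l_def m_def)
    have "routing y (- l) l n (M - {c})"
      unfolding routing_def
    proof (intro conjI ballI impI)
      show "- l \<le> n" "n + int K \<le> l" "finite (M - {c})" using mrD l by auto
      fix x assume x: "x \<in> X" "\<forall>j. - l \<le> j \<and> j \<le> l \<longrightarrow> \<pi> x j = y j"
      then have "\<And>j. a \<le> j \<Longrightarrow> j \<le> b \<Longrightarrow> \<pi> x j = y j" using l by auto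
      from routingE[OF mrD(2) x(1) this]
      obtain z where z: "z \<in> fibre (\<pi> x)" "\<And>j. j \<le> a \<or> b \<le> j \<Longrightarrow> z j = x j" "state z n \<in> M" by metis
      have "agree (int k) (\<pi> z) y"
        unfolding agree_def fibreD(2)[OF z(1)] using l(3) by (auto intro!: x(2)[rule_format])
      then have "state z n \<noteq> c" using none fibreD(1)[OF z(1)] by blast
      then show "\<exists>z\<in>fibre (\<pi> x). (\<forall>j. j \<le> - l \<or> l \<le> j \<longrightarrow> z j = x j) \<and> state z n \<in> M - {c}"
        using z l by (intro bexI[of _ z]) auto
    qed
    then have "depth \<le> card (M - {c})" using depth_le mrD(1) by blast
    moreover have "card (M - {c}) < card M" using card_Diff1_less[OF mrD(6) c] .
    ultimately show False using mrD(3) by simp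
  qed
  then obtain s where s: "\<And>k. s k \<in> X" "\<And>k. agree (int k) (\<pi> (s k)) y" "\<And>k. state (s k) n = c"
    by metis
  obtain x where x: "x \<in> fibre y" "\<And>N::nat. \<exists>k\<ge>N. agree (int N) (s k) x"
    using fibre_cluster_point[of s, OF s(1,2)] by blast
  obtain k where k: "agree (int (nat \<bar>n\<bar> + K)) (s k) x" using x(2) by blast
  have "state (s k) n = state x n"
    by (intro state_eqI agreeD[OF k]) auto
  then show False using no that x(1) s(3) by metis
qed

lemma image_in: "x \<in> X \<Longrightarrow> \<pi> x \<in> Y"
  using image by blast

lemma fibre_nonempty: "y \<in> Y \<Longrightarrow> \<exists>x. x \<in> fibre y"
  using image by (auto simp: fibre_def)

section \<open>Rigidity of minimal routings\<close>

definition passages :: "(int \<Rightarrow> 'b) \<Rightarrow> int \<Rightarrow> int \<Rightarrow> 'a list set \<Rightarrow> ('a list \<times> 'a list) set" where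
  "passages v n T M = {(state z n, state z (n + T)) | z. z \<in> fibre v \<and> state z n \<in> M \<and> state z (n + T) \<in> M}"

lemma passages_fibreI: "\<lbrakk>z \<in> fibre v; state z n \<in> M; state z (n + T) \<in> M\<rbrakk> \<Longrightarrow> (state z n, state z (n + T)) \<in> passages v n T M"
  by (auto simp: passages_def)

text \<open>The point \<open>v\<close> shows the window of \<open>y\<close> both at its place and shifted by \<open>T\<close>; the two
  copies share at most one coordinate.\<close>

definition recurs :: "(int \<Rightarrow> 'b) \<Rightarrow> int \<Rightarrow> int \<Rightarrow> (int \<Rightarrow> 'b) \<Rightarrow> int \<Rightarrow> bool" where
  "recurs y a b v T \<longleftrightarrow> v \<in> Y \<and> b - a \<le> T \<and>
     (\<forall>j. a \<le> j \<longrightarrow> j \<le> b \<longrightarrow> v j = y j \<and> v (j + T) = y j)"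

lemma recursD:
  assumes "recurs y a b v T"
  shows "v \<in> Y" "b - a \<le> T" "a \<le> j \<Longrightarrow> j \<le> b \<Longrightarrow> v j = y j"
    "a \<le> j \<Longrightarrow> j \<le> b \<Longrightarrow> v (j + T) = y j"
  using assms by (auto simp: recurs_def)

lemma recurs_minimal_routing:
  assumes "minimal_routing y a b n M" "recurs y a b v T"
  shows "minimal_routing v a b n M" "minimal_routing v (a + T) (b + T) (n + T) M"
proof -
  show "minimal_routing v a b n M"
    using recursD[OF assms(2)] by (intro minimal_routing_cong[OF assms(1)])
  have "minimal_routing (translate (- T) y) (a + T) (b + T) (n + T) M"
    using minimal_routing_translate[OF assms(1), of "- T"] by simp
  then show "minimal_routing v (a + T) (b + T) (n + T) M"
    using recursD[OF assms(2)] recursD(4)[OF assms(2), of "j - T" for j]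
    by (elim minimal_routing_cong) auto
qed

text \<open>It suffices that \<open>z\<close> lies over \<open>v\<close> between the two occurrences: every state of \<open>M\<close> occurs in the
  whole fibre, so the ends of \<open>z\<close> can be replaced.\<close>

lemma passagesI:
  assumes mr: "minimal_routing y a b n M" and rec: "recurs y a b v T"
    and z: "z \<in> X" "\<And>j. n + int r \<le> j \<Longrightarrow> j < n + T + int r \<Longrightarrow> \<pi> z j = v j"
    and M: "state z n \<in> M" "state z (n + T) \<in> M"
  shows "(state z n, state z (n + T)) \<in> passages v n T M"
proof -
  note D = minimal_routingD[OF mr]
  have T: "0 \<le> T" using D(4,5) recursD(2)[OF rec] by simp
  obtain e where e: "e \<in> fibre v" "state e n = state z n"
    using minimal_routing_state_realized[OF recurs_minimal_routing(1)[OF mr rec] M(1)] .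
  obtain e' where e': "e' \<in> fibre v" "state e' (n + T) = state z (n + T)"
    using minimal_routing_state_realized[OF recurs_minimal_routing(2)[OF mr rec] M(2)] .
  define z1 where "z1 = splice n e z"
  have z1: "z1 \<in> fibre (splice (n + int r) v (\<pi> z))"
    unfolding z1_def using e z(1) by (intro splice_fibre) (auto simp: fibre_def splice_apply)
  have st: "state z1 n = state z n" "state z1 (n + T) = state z (n + T)"
    using e(2) T by (auto simp: z1_def state_splice)
  define z2 where "z2 = splice (n + T) z1 e'"
  have "z2 \<in> fibre v"
    unfolding z2_def using z1 e' st z(2)
    by (intro splice_fibre) (auto simp: fibre_def splice_apply)
  moreover have "state z2 n = state z n" "state z2 (n + T) = state z (n + T)"
    using st e'(2) T by (auto simp: z2_def state_splice)
  ultimately show ?thesis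
    using passages_fibreI[of z2 v n M T] M by simp
qed

text \<open>The two points overlap in one occurrence of the window, which is at least \<open>K\<close> long, so they can be
  spliced there.\<close>

lemma recurs_concat:
  assumes mr: "minimal_routing y a b n M"
    and rec: "recurs y a b v T" and rec': "recurs y a b v' T'"
  defines "vv \<equiv> splice (a + T) v (translate (- T) v')"
  shows "recurs y a b vv (T + T')"
    and "j \<le> b + T \<Longrightarrow> vv j = v j" and "a + T \<le> j \<Longrightarrow> vv j = v' (j - T)"
proof -
  note D = minimal_routingD[OF mr]
  have ov: "v j = v' (j - T)" if "a + T \<le> j" "j \<le> b + T" for j
    using recursD(4)[OF rec, of "j - T"] recursD(3)[OF rec', of "j - T"] that by simp
  show L: "vv j = v j" if "j \<le> b + T" for j
    using ov that by (auto simp: vv_def splice_apply)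
  show R: "vv j = v' (j - T)" if "a + T \<le> j" for j
    using that by (auto simp: vv_def splice_apply)
  have "vv \<in> Y"
    unfolding vv_def using ov D(4,5)
    by (intro cod.splice cod.translate recursD(1)[OF rec] recursD(1)[OF rec']) auto
  moreover have "vv j = y j \<and> vv (j + (T + T')) = y j" if "a \<le> j" "j \<le> b" for j
    using L[of j] R[of "j + (T + T')"] recursD(3,4)[OF rec, of j] recursD(3,4)[OF rec', of j] recursD(2)[OF rec] recursD(2)[OF rec'] D(4,5) that
    by (simp add: algebra_simps)
  ultimately show "recurs y a b vv (T + T')"
    using recursD(2)[OF rec] recursD(2)[OF rec'] D(4,5) by (auto simp: recurs_def)
qed

text \<open>Composable passages are spliced at their common state. A passage over both stretches can be rerouted in
  the middle window through \<open>M\<close>, and so splits.\<close>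

lemma passages_concat:
  assumes mr: "minimal_routing y a b n M"
    and rec: "recurs y a b v T" and rec': "recurs y a b v' T'"
  shows "passages v n T M O passages v' n T' M = passages (splice (a + T) v (translate (- T) v')) n (T + T') M"
    (is "_ = passages ?vv n _ M")
proof (intro equalityI subrelI)
  note D = minimal_routingD[OF mr] and RC = recurs_concat[OF mr rec rec']
  have T: "0 < T" "0 < T'" "int K \<le> T" "b - a \<le> T" "b - a \<le> T'"
    using radius D(4,5) recursD(2)[OF rec] recursD(2)[OF rec'] by auto
  {
    fix c g assume "(c, g) \<in> passages v n T M O passages v' n T' M"
    then obtain z z' where z: "z \<in> fibre v" "state z n = c" "c \<in> M" "state z (n + T) = state z' n"
      and z': "z' \<in> fibre v'" "state z' (n + T') = g" "g \<in> M"
      by (auto simp: passages_def)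
    define zz where "zz = splice (n + T) z (translate (- T) z')"
    have st: "state z (n + T) = state (translate (- T) z') (n + T)"
      using z(4) by simp
    have "zz \<in> fibre ?vv"
      unfolding zz_def
    proof (rule splice_fibre)
      show "\<pi> z j = ?vv j" if "j < n + T + int r" for j
        using RC(2)[of j] that D(5) radius fibreD(2)[OF z(1)] by simp
      show "\<pi> (translate (- T) z') j = ?vv j" if "n + T + int r \<le> j" for j
        using RC(3)[of j] that D(4) fibreD[OF z'(1)] by (simp add: translate)
    qed (use z(1) z'(1) st dom.translate in \<open>auto simp: fibre_def\<close>)
    moreover have "state zz n = c" "state zz (n + (T + T')) = g"
      using state_splice[OF st] T z(2) z'(2) by (auto simp: zz_def algebra_simps)
    ultimately show "(c, g) \<in> passages ?vv n (T + T') M"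
      using passages_fibreI[of zz ?vv n M "T + T'"] z(3) z'(3) by simp
  next
    fix c g assume "(c, g) \<in> passages ?vv n (T + T') M"
    then obtain z where z: "z \<in> fibre ?vv" "state z n = c" "c \<in> M" "state z (n + (T + T')) = g" "g \<in> M"
      by (auto simp: passages_def)
    have "routing v (a + T) (b + T) (n + T) M"
      using recurs_minimal_routing(2)[OF mr rec] minimal_routingD(2) by blast
    moreover have "\<pi> z j = v j" if "j \<le> b + T" for j
      using RC(2)[OF that] fibreD(2)[OF z(1)] by simp
    ultimately obtain w where w: "w \<in> fibre (\<pi> z)" "\<And>j. j \<le> a + T \<or> b + T \<le> j \<Longrightarrow> w j = z j" "state w (n + T) \<in> M"
      using routingE[of v "a + T" "b + T" "n + T" M z] fibreD(1)[OF z(1)] by metis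
    have st: "state w n = c" "state w (n + (T + T')) = g"
      using z(2,4) w(2) D(4,5) T by (auto intro!: state_eqI)
    have pw: "\<pi> w = ?vv" "w \<in> X" using w(1) z(1) by (auto simp: fibre_def)
    have "(state w n, state w (n + T)) \<in> passages v n T M"
      using pw st w(3) z(3) RC(2) D(5) radius by (intro passagesI[OF mr rec]) auto
    moreover have "(state (translate T w) n, state (translate T w) (n + T')) \<in> passages v' n T' M"
    proof (rule passagesI[OF mr rec'])
      show "\<pi> (translate T w) j = v' j" if "n + int r \<le> j" "j < n + T' + int r" for j
        using that RC(3)[of "j + T"] pw D(4) by (simp add: translate)
    qed (use pw dom.translate st w(3) z(5) in \<open>auto simp: algebra_simps\<close>)
    ultimately show "(c, g) \<in> passages v n T M O passages v' n T' M"
      using st by (auto simp: algebra_simps)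
  }
qed

text \<open>Over two consecutive copies of the stretch, three occurrences of the window are available. Routing a point
  through the outer ones leaves the connection between them to be chosen, and by assumption it can be
  made to pass the middle one in \<open>N\<close>. Hence \<open>N\<close> belongs to a routing and is not smaller than \<open>M\<close>.\<close>

lemma passages_minimal:
  assumes mr: "minimal_routing y a b n M" and rec: "recurs y a b v T"
    and N: "N \<subseteq> M" "\<And>c g. (c, g) \<in> passages v n T M O passages v n T M \<Longrightarrow>
        \<exists>m\<in>N. (c, m) \<in> passages v n T M \<and> (m, g) \<in> passages v n T M"
  shows "N = M"
proof -
  note D = minimal_routingD[OF mr] and RC = recurs_concat[OF mr rec rec]
  define vv where "vv = splice (a + T) v (translate (- T) v)"
  note RC = RC[folded vv_def]
  have T: "0 < T" "int K \<le> T" "b - a \<le> T"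
    using radius D(4,5) recursD(2)[OF rec] by auto
  have vv: "vv \<in> Y" using recursD(1)[OF RC(1)] .
  have mr0: "routing vv a b n M" and mr2: "routing vv (a + (T + T)) (b + (T + T)) (n + (T + T)) M"
    using recurs_minimal_routing[OF mr RC(1)] minimal_routingD(2) by blast+
  have "routing vv a (b + (T + T)) (n + T) N"
    unfolding routing_def
  proof (intro conjI ballI impI)
    show "a \<le> n + T" "n + T + int K \<le> b + (T + T)" "finite N"
      using D T N(1) finite_subset by auto
    fix x assume x: "x \<in> X" "\<forall>j. a \<le> j \<and> j \<le> b + (T + T) \<longrightarrow> \<pi> x j = vv j"
    \<comment> \<open>x1 and x2 route x through the first and the last occurrence.\<close>
    have "\<pi> x j = vv j" if "a \<le> j" "j \<le> b" for j
      using x(2) T that by auto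
    then obtain x1 where x1: "x1 \<in> fibre (\<pi> x)" "\<And>j. j \<le> a \<or> b \<le> j \<Longrightarrow> x1 j = x j" "state x1 n \<in> M"
      using routingE[OF mr0 x(1)] by metis
    have x1': "x1 \<in> X" "\<pi> x1 = \<pi> x" using x1(1) by (auto simp: fibre_def)
    have "\<pi> x1 j = vv j" if "a + (T + T) \<le> j" "j \<le> b + (T + T)" for j
      using x(2) x1'(2) T that by auto
    then obtain x2 where x2: "x2 \<in> fibre (\<pi> x1)"
      "\<And>j. j \<le> a + (T + T) \<or> b + (T + T) \<le> j \<Longrightarrow> x2 j = x1 j" "state x2 (n + (T + T)) \<in> M"
      using routingE[OF mr2 x1'(1)] by metis
    have x2': "x2 \<in> X" "\<pi> x2 = \<pi> x" using x2(1) x1' by (auto simp: fibre_def)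
    have "state x2 n = state x1 n"
      using x2(2) D T by (intro state_eqI) auto
    then have "(state x2 n, state x2 (n + (T + T))) \<in> passages vv n (T + T) M"
      using x2' x2(3) x1(3) x(2) D radius by (intro passagesI[OF mr RC(1)]) auto
    then have "(state x2 n, state x2 (n + (T + T))) \<in> passages v n T M O passages v n T M"
      unfolding passages_concat[OF mr rec rec] vv_def .
    then obtain m where m: "m \<in> N" "(state x2 n, m) \<in> passages v n T M" "(m, state x2 (n + (T + T))) \<in> passages v n T M"
      using N(2) by blast
    obtain z where z: "z \<in> fibre v" "state z n = state x2 n" "state z (n + T) = m"
      using m(2) by (auto simp: passages_def)
    obtain z' where z': "z' \<in> fibre v" "state z' n = m" "state z' (n + T) = state x2 (n + (T + T))"
      using m(3) by (auto simp: passages_def)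
    \<comment> \<open>u3 follows x2 up to n, then z and z' over the two stretches, and x2 again from the last occurrence on.\<close>
    define u1 where "u1 = splice n x2 z"
    have u1: "u1 \<in> fibre (splice (n + int r) (\<pi> x) v)"
      unfolding u1_def using x2' z(1,2) by (intro splice_fibre) (auto simp: fibre_def splice_apply)
    have st1: "state u1 n = state x2 n" "state u1 (n + T) = m"
      using z T by (auto simp: u1_def state_splice)
    define u2 where "u2 = splice (n + T) u1 (translate (- T) z')"
    have st: "state u1 (n + T) = state (translate (- T) z') (n + T)"
      using st1 z' by simp
    have u2: "u2 \<in> fibre (splice (n + int r) (\<pi> x) vv)"
      unfolding u2_def
    proof (rule splice_fibre)
      show "\<pi> u1 j = splice (n + int r) (\<pi> x) vv j" if "j < n + T + int r" for j
        using RC(2)[of j] that D(5) radius fibreD(2)[OF u1] by (simp add: splice_apply)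
      show "\<pi> (translate (- T) z') j = splice (n + int r) (\<pi> x) vv j" if "n + T + int r \<le> j" for j
        using RC(3)[of j] that D(4) T fibreD[OF z'(1)] by (simp add: translate splice_apply)
    qed (use u1 z'(1) st dom.translate in \<open>auto simp: fibre_def\<close>)
    have st2: "state u2 n = state x2 n" "state u2 (n + T) = m" "state u2 (n + (T + T)) = state x2 (n + (T + T))"
      using st1 z' state_splice[OF st] T by (auto simp: u2_def algebra_simps)
    define u3 where "u3 = splice (n + (T + T)) u2 x2"
    have u3: "u3 \<in> fibre (\<pi> x)"
      unfolding u3_def
    proof (rule splice_fibre)
      show "\<pi> u2 j = \<pi> x j" if "j < n + (T + T) + int r" for j
        using x(2) that D radius fibreD(2)[OF u2] by (simp add: splice_apply)
    qed (use u2 x2' st2 in \<open>auto simp: fibre_def\<close>)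
    have "state u3 (n + T) = m"
      using state_splice[OF st2(3)] st2(2) T by (simp add: u3_def)
    moreover have "u3 j = x j" if "j \<le> a \<or> b + (T + T) \<le> j" for j
    proof (cases "j \<le> a")
      case True
      then have "u3 j = u2 j" "u2 j = u1 j" "u1 j = x2 j"
        using splice_left[OF st2(3), of j] splice_left[OF st, of j] splice_left[OF z(2)[symmetric], of j] D(4) T True radius
        by (auto simp: u3_def u2_def u1_def)
      then show ?thesis
        using x1(2)[of j] x2(2)[of j] True T D(4) radius by simp
    next
      case False
      then show ?thesis
        using that x1(2)[of j] x2(2)[of j] D(4,5) T by (simp add: u3_def splice_apply)
    qed
    ultimately show "\<exists>z\<in>fibre (\<pi> x). (\<forall>j. j \<le> a \<or> b + (T + T) \<le> j \<longrightarrow> z j = x j) \<and> state z (n + T) \<in> N"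
      using u3 m(1) by blast
  qed
  then have "depth \<le> card N" using depth_le vv by blast
  then show "N = M" using D(3,6) N(1) by (simp add: card_seteq)
qed

definition returns :: "(int \<Rightarrow> 'b) \<Rightarrow> int \<Rightarrow> int \<Rightarrow> int \<Rightarrow> 'a list set \<Rightarrow> ('a list \<times> 'a list) set set" where
  "returns y a b n M = {passages v n T M | v T. recurs y a b v T}"

text \<open>A point that follows one preimage of \<open>y\<close> on the left and a translate of another on the right has an
  image with two occurrences of the window; the margin \<open>r\<close> is what the local rule reads.\<close>

lemma image_recurs:
  assumes mr: "minimal_routing y a b n M"
    and z: "z \<in> X" "b - a \<le> T" and e: "e \<in> fibre y" "e' \<in> fibre y" and q: "b \<le> q" "i \<le> a"
    and left: "\<And>j. j \<le> q + int r \<Longrightarrow> z j = e j" and right: "\<And>j. i - int r \<le> j \<Longrightarrow> z (j + T) = e' j"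
  shows "recurs y a b (\<pi> z) T"
    and "j \<le> q \<Longrightarrow> \<pi> z j = y j" and "i \<le> j \<Longrightarrow> \<pi> z (j + T) = y j"
proof -
  show L: "\<pi> z j = y j" if "j \<le> q" for j
  proof -
    have "\<pi> z j = \<pi> e j"
      using that by (intro local_rule z(1) fibreD(1)[OF e(1)] left) auto
    then show ?thesis using fibreD(2)[OF e(1)] by simp
  qed
  show R: "\<pi> z (j + T) = y j" if "i \<le> j" for j
  proof -
    have "\<pi> (translate T z) j = \<pi> e' j"
      using that right by (intro local_rule dom.translate z(1) fibreD(1)[OF e(2)]) auto
    then show ?thesis using fibreD(2)[OF e(2)] translate[OF z(1)] by simp
  qed
  show "recurs y a b (\<pi> z) T"
    using L R z image_in q by (auto simp: recurs_def)
qed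

text \<open>Given two states of \<open>M\<close>, irreducibility of \<open>X\<close> joins a preimage that shows the first to one that shows the
  second, and the image of the joint point shows the window twice.\<close>

lemma returns_minimal_transitive:
  assumes mr: "minimal_routing y a b n M"
  shows "minimal_transitive_relations M (returns y a b n M)"
proof
  show "finite M" using minimal_routingD(6)[OF mr] .
  show "B \<subseteq> M \<times> M" if "B \<in> returns y a b n M" for B
    using that by (auto simp: returns_def passages_def)
  show "B O B' \<in> returns y a b n M" if "B \<in> returns y a b n M" "B' \<in> returns y a b n M" for B B'
    using that passages_concat[OF mr] recurs_concat(1)[OF mr] unfolding returns_def by blast
  show "N = M" if B: "B \<in> returns y a b n M" and N: "N \<subseteq> M"
    "\<And>c g. (c, g) \<in> B O B \<Longrightarrow> \<exists>m\<in>N. (c, m) \<in> B \<and> (m, g) \<in> B" for B N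
    using B passages_minimal[OF mr _ N(1)] N(2) unfolding returns_def by blast
  fix c f assume M: "c \<in> M" "f \<in> M"
  note D = minimal_routingD[OF mr]
  obtain e where e: "e \<in> fibre y" "state e n = c"
    using minimal_routing_state_realized[OF mr M(1)] .
  obtain e' where e': "e' \<in> fibre y" "state e' n = f"
    using minimal_routing_state_realized[OF mr M(2)] .
  obtain z T where z: "z \<in> X" "b + int r < a - int r + T" "\<And>j. j \<le> b + int r \<Longrightarrow> z j = e j"
    "\<And>j. a - int r \<le> j \<Longrightarrow> z (j + T) = e' j"
    using dom.join[OF fibreD(1)[OF e(1)] fibreD(1)[OF e'(1)], of "b + int r" "a - int r"] by metis
  have rec: "recurs y a b (\<pi> z) T"
    using image_recurs(1)[OF mr z(1) _ e(1) e'(1) order_refl order_refl z(3,4)] z(2) by simp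
  have "state z n = c" "state z (n + T) = f"
    using z(3) z(4)[of "j - T" for j] e(2) e'(2) D by (auto simp: factor_eq_iff)
  then have "(c, f) \<in> passages (\<pi> z) n T M"
    using passages_fibreI[of z "\<pi> z" n M T] M z(1) by (simp add: fibre_def)
  then show "\<exists>B\<in>returns y a b n M. (c, f) \<in> B"
    using rec unfolding returns_def by blast
qed

text \<open>Let \<open>u\<close> follow \<open>z1\<close> through the window and then return to the past of \<open>z1\<close>, so that it reaches the
  window a second time as \<open>z1\<close> does. On this second visit \<open>u\<close> can leave \<open>z1\<close> for \<open>z2\<close> at \<open>i\<close>. Thus the state
  of \<open>z1\<close> is followed both by itself and by the state of \<open>z2\<close>, and the relation is a permutation.\<close>

lemma minimal_routing_state_forward:
  assumes mr: "minimal_routing y a b n M" and z: "z1 \<in> fibre y" "z2 \<in> fibre y"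
    and i: "state z1 i = state z2 i" "i \<le> a" and M: "state z1 n \<in> M" "state z2 n \<in> M"
  shows "state z1 n = state z2 n"
proof -
  note D = minimal_routingD[OF mr]
  interpret minimal_transitive_relations M "returns y a b n M"
    using returns_minimal_transitive[OF mr] .
  obtain u T where u: "u \<in> X" "b + int r < i - int r + T" "\<And>j. j \<le> b + int r \<Longrightarrow> u j = z1 j"
    "\<And>j. i - int r \<le> j \<Longrightarrow> u (j + T) = z1 j"
    using dom.join[OF fibreD(1)[OF z(1)] fibreD(1)[OF z(1)], of "b + int r" "i - int r"] by metis
  have T: "b - a \<le> T" using u(2) i(2) by simp
  note R = image_recurs[OF mr u(1) T z(1) z(1) order_refl i(2) u(3,4)]
  have st: "state u n = state z1 n" "state u (n + T) = state z1 n" "state u (i + T) = state z1 i"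
    using u(3) u(4)[of "j - T" for j] i(2) D by (auto simp: factor_eq_iff algebra_simps)
  define u' where "u' = splice (i + T) u (translate (- T) z2)"
  have eq: "state u (i + T) = state (translate (- T) z2) (i + T)"
    using st i by simp
  have "u' \<in> fibre (\<pi> u)"
    unfolding u'_def
  proof (rule splice_fibre)
    show "\<pi> (translate (- T) z2) j = \<pi> u j" if "j \<ge> i + T + int r" for j
      using R(3)[of "j - T"] that fibreD[OF z(2)] by (simp add: translate)
  qed (use u(1) z(2) eq dom.translate in \<open>auto simp: fibre_def\<close>)
  moreover have "state u' n = state z1 n"
    using state_splice[OF eq] st(1) u(2) D(5) by (auto simp: u'_def)
  moreover have "state u' (n + T) = state z2 n"
    using state_splice[OF eq] eq i(2) D(4) by (cases "n = i") (auto simp: u'_def)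
  ultimately have "(state z1 n, state z2 n) \<in> passages (\<pi> u) n T M"
    using passages_fibreI[of u' "\<pi> u" n M T] M by simp
  moreover have "(state z1 n, state z1 n) \<in> passages (\<pi> u) n T M"
    using passages_fibreI[of u "\<pi> u" n M T] M u(1) st by (simp add: fibre_def)
  moreover have "passages (\<pi> u) n T M \<in> returns y a b n M"
    using R(1) by (auto simp: returns_def)
  ultimately show ?thesis using functional by blast
qed

text \<open>As in the forward case, but now the first visit is varied: it follows \<open>z2\<close> up to \<open>i\<close>. The point \<open>u\<close> has
  to keep \<open>z1\<close> long enough for the common state at \<open>i\<close> to be visible, whence the bound \<open>q\<close>.\<close>

lemma minimal_routing_state_backward:
  assumes mr: "minimal_routing y a b n M" and z: "z1 \<in> fibre y" "z2 \<in> fibre y"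
    and i: "state z1 i = state z2 i" "b \<le> i" and M: "state z1 n \<in> M" "state z2 n \<in> M"
  shows "state z1 n = state z2 n"
proof -
  note D = minimal_routingD[OF mr]
  interpret minimal_transitive_relations M "returns y a b n M"
    using returns_minimal_transitive[OF mr] .
  define q where "q = i + int K"
  have q: "b \<le> q" using i(2) by (simp add: q_def)
  obtain u T where u: "u \<in> X" "q + int r < a - int r + T" "\<And>j. j \<le> q + int r \<Longrightarrow> u j = z1 j"
    "\<And>j. a - int r \<le> j \<Longrightarrow> u (j + T) = z1 j"
    using dom.join[OF fibreD(1)[OF z(1)] fibreD(1)[OF z(1)], of "q + int r" "a - int r"] by metis
  have T: "b - a \<le> T" using u(2) q by simp
  note R = image_recurs[OF mr u(1) T z(1) z(1) q order_refl u(3,4)]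
  have st: "state u n = state z1 n" "state u (n + T) = state z1 n" "state u i = state z1 i"
    using u(3) u(4)[of "j - T" for j] i(2) D by (auto simp: factor_eq_iff algebra_simps q_def)
  define u' where "u' = splice i z2 u"
  have eq: "state z2 i = state u i"
    using st i by simp
  have "u' \<in> fibre (\<pi> u)"
    unfolding u'_def
  proof (rule splice_fibre)
    show "\<pi> z2 j = \<pi> u j" if "j < i + int r" for j
      using R(2)[of j] that fibreD[OF z(2)] radius by (simp add: q_def)
  qed (use u(1) z(2) eq in \<open>auto simp: fibre_def\<close>)
  moreover have "state u' n = state z2 n" "state u' (n + T) = state z1 n"
    using state_splice[OF eq] st u(2) i D radius by (auto simp: u'_def q_def)
  ultimately have "(state z2 n, state z1 n) \<in> passages (\<pi> u) n T M"
    using passages_fibreI[of u' "\<pi> u" n M T] M by simp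
  moreover have "(state z1 n, state z1 n) \<in> passages (\<pi> u) n T M"
    using passages_fibreI[of u "\<pi> u" n M T] M u(1) st by (simp add: fibre_def)
  moreover have "passages (\<pi> u) n T M \<in> returns y a b n M"
    using R(1) by (auto simp: returns_def)
  ultimately show ?thesis using injective by blast
qed

section \<open>Right equivalence classes\<close>

lemma right_bridge_fibre:
  "x \<in> fibre y \<Longrightarrow> right_bridge X \<pi> m x x' z \<longleftrightarrow>
     z \<in> fibre y \<and> (\<exists>n>m. (\<forall>j\<le>m. z j = x j) \<and> (\<forall>j\<ge>n. z j = x' j))"
  by (auto simp: right_bridge_def fibre_def)

lemma left_bridge_fibre:
  "x \<in> fibre y \<Longrightarrow> left_bridge X \<pi> m x x' z \<longleftrightarrow>
     z \<in> fibre y \<and> (\<exists>n<m. (\<forall>j\<le>n. z j = x' j) \<and> (\<forall>j\<ge>m. z j = x j))"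
  by (auto simp: left_bridge_def fibre_def)

lemma right_transitionE:
  assumes "right_transition X \<pi> x x'" "x \<in> fibre y"
  obtains z n where "z \<in> fibre y" "n > m" "\<And>j. j \<le> m \<Longrightarrow> z j = x j" "\<And>j. j \<ge> n \<Longrightarrow> z j = x' j"
  using assms unfolding right_transition_def right_bridge_fibre[OF assms(2)] by blast

lemma right_bridge_mono: "right_bridge X \<pi> m' x x' z \<Longrightarrow> m \<le> m' \<Longrightarrow> right_bridge X \<pi> m x x' z"
  by (force simp: right_bridge_def)

lemma right_transition_trans:
  assumes x: "x \<in> fibre y" "x' \<in> fibre y" "x'' \<in> fibre y"
    and t: "right_transition X \<pi> x x'" "right_transition X \<pi> x' x''"
  shows "right_transition X \<pi> x x''"
  unfolding right_transition_def
proof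
  fix m
  obtain z n where z: "z \<in> fibre y" "n > m" "\<And>j. j \<le> m \<Longrightarrow> z j = x j" "\<And>j. j \<ge> n \<Longrightarrow> z j = x' j"
    by (rule right_transitionE[OF t(1) x(1), where m = m]) blast
  obtain z' n' where z': "z' \<in> fibre y" "n' > n + int K" "\<And>j. j \<le> n + int K \<Longrightarrow> z' j = x' j" "\<And>j. j \<ge> n' \<Longrightarrow> z' j = x'' j"
    by (rule right_transitionE[OF t(2) x(2), where m = "n + int K"]) blast
  have "splice n z z' \<in> fibre y"
    using z z' by (intro splice_same_fibre state_eqI) auto
  then have "right_bridge X \<pi> m x x'' (splice n z z')"
    using z z' unfolding right_bridge_fibre[OF x(1)]
    by (auto intro!: exI[of _ n'] simp: splice_apply)
  then show "\<exists>z. right_bridge X \<pi> m x x'' z" by blast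
qed

abbreviation right_equivalence :: "((int \<Rightarrow> 'a) \<times> (int \<Rightarrow> 'a)) set" where
  "right_equivalence \<equiv> {(x, x'). right_equivalent X \<pi> x x'}"

lemma equiv_right: "equiv X right_equivalence"
proof (intro equivI)
  show "right_equivalence \<subseteq> X \<times> X" by (auto simp: right_equivalent_def)
  have "right_bridge X \<pi> m x x x" if "x \<in> X" for x m
    using that by (auto simp: right_bridge_def intro: exI[of _ "m + 1"])
  then show "refl_on X right_equivalence"
    by (auto simp: refl_on_def right_equivalent_def right_transition_def)
  show "sym right_equivalence"
    by (auto simp: sym_def right_equivalent_def)
  show "trans right_equivalence"
  proof (rule transI)
    fix x x' x'' assume "(x, x') \<in> right_equivalence" "(x', x'') \<in> right_equivalence"
    then show "(x, x'') \<in> right_equivalence"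
      using right_transition_trans[of x "\<pi> x" x' x''] right_transition_trans[of x'' "\<pi> x" x' x]
      by (auto simp: right_equivalent_def fibre_def)
  qed
qed

lemma right_classes_eq: "right_classes X \<pi> y = (\<lambda>x. right_equivalence `` {x}) ` fibre y"
  by (auto simp: right_classes_def quotient_def fibre_def)

lemma right_class_eq_iff:
  assumes "x \<in> fibre y" "x' \<in> fibre y"
  shows "right_equivalence `` {x} = right_equivalence `` {x'} \<longleftrightarrow>
    right_transition X \<pi> x x' \<and> right_transition X \<pi> x' x"
proof -
  have "right_equivalence `` {x} = right_equivalence `` {x'} \<longleftrightarrow> (x, x') \<in> right_equivalence"
    using equiv_class_eq_iff[OF equiv_right] assms fibreD(1) by blast
  then show ?thesis using assms by (simp add: right_equivalent_def fibre_def)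
qed

text \<open>For finitely many pairwise inequivalent points there is a coordinate \<open>m\<close> beyond which each pair lacks a
  bridge in one of the two directions. A colouring for this \<open>m\<close> has to separate all of them.\<close>

lemma right_classes_le_colours:
  assumes colour: "\<And>m. \<exists>g :: (int \<Rightarrow> 'a) \<Rightarrow> 'a list. \<exists>S. finite S \<and> card S \<le> d \<and> g ` fibre y \<subseteq> S \<and>
      (\<forall>x\<in>fibre y. \<forall>x'\<in>fibre y. g x = g x' \<longrightarrow> (\<exists>z. right_bridge X \<pi> m x x' z))"
  shows "finite (right_classes X \<pi> y)" and "num_right_classes X \<pi> y \<le> d"
proof -
  define cl where "cl = (\<lambda>x. right_equivalence `` {x})"
  have "finite (right_classes X \<pi> y) \<and> card (right_classes X \<pi> y) \<le> d"
  proof (rule ccontr)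
    assume "\<not> ?thesis"
    then obtain Q where Q: "Q \<subseteq> right_classes X \<pi> y" "finite Q" "card Q = Suc d"
      by (metis infinite_arbitrarily_large not_less_eq_eq obtain_subset_with_card_n)
    then obtain P where P: "P \<subseteq> fibre y" "inj_on cl P" "Q = cl ` P"
      unfolding right_classes_eq cl_def[symmetric] by (meson subset_image_inj)
    have finP: "finite P" "card P = Suc d"
      using P Q by (auto simp: finite_image_iff card_image)
    define bad where "bad = (\<lambda>m x x'. \<not> (\<exists>z. right_bridge X \<pi> m x x' z) \<or> \<not> (\<exists>z. right_bridge X \<pi> m x' x z))"
    have "eventually (\<lambda>m. bad m x x') at_top" if xx: "x \<in> P" "x' \<in> P" "x \<noteq> x'" for x x'
    proof -
      have "cl x \<noteq> cl x'" using xx P(2) by (auto dest: inj_onD)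
      moreover have "x \<in> fibre y" "x' \<in> fibre y" using xx P(1) by auto
      ultimately have "\<exists>m. bad m x x'"
        using right_class_eq_iff[of x y x'] unfolding cl_def bad_def right_transition_def by blast
      then obtain m where "bad m x x'" ..
      then have "bad m' x x'" if "m' \<ge> m" for m'
        using that right_bridge_mono unfolding bad_def by blast
      then show ?thesis unfolding eventually_at_top_linorder by blast
    qed
    then have "\<forall>p\<in>P \<times> P. eventually (\<lambda>m. fst p \<noteq> snd p \<longrightarrow> bad m (fst p) (snd p)) at_top"
      by (auto simp: eventually_mono)
    then have "eventually (\<lambda>m. \<forall>p\<in>P \<times> P. fst p \<noteq> snd p \<longrightarrow> bad m (fst p) (snd p)) at_top"
      using finP by (intro eventually_ball_finite) auto
    then obtain m where m: "\<And>x x'. x \<in> P \<Longrightarrow> x' \<in> P \<Longrightarrow> x \<noteq> x' \<Longrightarrow> bad m x x'"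
      by (auto dest!: eventually_happens)
    obtain g :: "(int \<Rightarrow> 'a) \<Rightarrow> 'a list" and S where g: "finite S" "card S \<le> d" "g ` fibre y \<subseteq> S"
      "\<forall>x\<in>fibre y. \<forall>x'\<in>fibre y. g x = g x' \<longrightarrow> (\<exists>z. right_bridge X \<pi> m x x' z)"
      using colour[of m] by (elim exE conjE) (rule that)
    have "card (g ` P) \<le> d"
      using g P(1) by (meson card_mono image_mono le_trans order_trans)
    then obtain x x' where xx: "x \<in> P" "x' \<in> P" "x \<noteq> x'" "g x = g x'"
      using finP pigeonhole[of g P] unfolding inj_on_def by force
    then have "x \<in> fibre y" "x' \<in> fibre y" using P(1) by auto
    then show False
      using m[OF xx(1-3)] g(4)[rule_format, of x x'] g(4)[rule_format, of x' x] xx(4) unfolding bad_def by simp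
  qed
  then show "finite (right_classes X \<pi> y)" "num_right_classes X \<pi> y \<le> d"
    by (auto simp: num_right_classes_def)
qed

text \<open>Points with the same state can be switched at once, so states are colours.\<close>

lemma finite_right_classes: "finite (right_classes X \<pi> y)"
proof (rule right_classes_le_colours)
  fix m
  let ?S = "range (\<lambda>(x, n). state x n)"
  have "right_bridge X \<pi> m x x' (splice (m + 1) x x')"
    if "x \<in> fibre y" "x' \<in> fibre y" "state x (m + 1) = state x' (m + 1)" for x x'
    using that splice_same_fibre[OF that] unfolding right_bridge_fibre[OF that(1)]
    by (auto intro!: exI[of _ "m + 1"] simp: splice_apply)
  then show "\<exists>g :: (int \<Rightarrow> 'a) \<Rightarrow> 'a list. \<exists>S. finite S \<and> card S \<le> card ?S \<and> g ` fibre y \<subseteq> S \<and>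
      (\<forall>x\<in>fibre y. \<forall>x'\<in>fibre y. g x = g x' \<longrightarrow> (\<exists>z. right_bridge X \<pi> m x x' z))"
    using finite_states by (intro exI[of _ "\<lambda>x. state x (m + 1)"] exI[of _ ?S]) auto
qed

text \<open>Every preimage can be led to the chosen representative of its class and back. Since only finitely many
  states and representatives are involved, the representatives are reached by a common time \<open>n\<close>, and the
  states of the representatives at \<open>n\<close> form \<open>M\<close>. The time needed to come back may depend on the preimage;
  that a common window suffices, also for preimages of the window only, is compactness.\<close>

lemma routing_from_right_classes:
  assumes y: "y \<in> Y"
  shows "\<exists>a b n M. routing y a b n M \<and> card M \<le> num_right_classes X \<pi> y"
proof -
  define cl where "cl = (\<lambda>x. right_equivalence `` {x})"
  obtain R where R: "R \<subseteq> fibre y" "inj_on cl R" "right_classes X \<pi> y = cl ` R"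
    unfolding right_classes_eq cl_def[symmetric] by (meson subset_image_inj subset_refl)
  have finR: "finite R" "card R = num_right_classes X \<pi> y"
    using finite_right_classes[of y] R(2) unfolding num_right_classes_def R(3)
    by (auto simp: finite_image_iff card_image)
  have "\<exists>\<rho>\<in>R. right_transition X \<pi> x \<rho> \<and> right_transition X \<pi> \<rho> x" if x: "x \<in> fibre y" for x
  proof -
    have "cl x \<in> cl ` R" using x R(3) by (auto simp: right_classes_eq cl_def)
    then obtain \<rho> where "\<rho> \<in> R" "cl x = cl \<rho>" by blast
    then show ?thesis using right_class_eq_iff[OF x, of \<rho>] R(1) unfolding cl_def by blast
  qed
  then obtain rep where rep: "\<And>x. x \<in> fibre y \<Longrightarrow> rep x \<in> R"
    "\<And>x. x \<in> fibre y \<Longrightarrow> right_transition X \<pi> x (rep x)"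
    "\<And>x. x \<in> fibre y \<Longrightarrow> right_transition X \<pi> (rep x) x"
    by metis
  have repF: "rep x \<in> fibre y" if "x \<in> fibre y" for x
    using rep(1)[OF that] R(1) by blast
  \<comment> \<open>The state at 1 - K is the one that ends at coordinate 0.\<close>
  define i where "i = 1 - int K"
  define key where "key = (\<lambda>x. (state x i, rep x))"
  define good where "good = (\<lambda>n x. \<exists>z\<in>fibre y. (\<forall>j\<le>0. z j = x j) \<and> (\<forall>j\<ge>n. z j = rep x j))"
  have "finite (key ` fibre y)"
    by (rule finite_subset[OF _ finite_cartesian_product[OF finite_states finR(1)]])
       (use rep(1) in \<open>auto simp: key_def\<close>)
  moreover have "eventually (\<lambda>n. \<forall>x\<in>fibre y. key x = p \<longrightarrow> good n x) at_top"
    if "p \<in> key ` fibre y" for p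
  proof -
    obtain x0 where x0: "x0 \<in> fibre y" "p = key x0" using \<open>p \<in> key ` fibre y\<close> by blast
    obtain z n where z: "z \<in> fibre y" "n > 0" "\<And>j. j \<le> 0 \<Longrightarrow> z j = x0 j" "\<And>j. j \<ge> n \<Longrightarrow> z j = rep x0 j"
      by (rule right_transitionE[OF rep(2)[OF x0(1)] x0(1), where m = 0]) blast
    have "good n' x" if "x \<in> fibre y" "key x = p" "n' \<ge> n" for x n'
    proof -
      have k: "state x i = state x0 i" "rep x = rep x0" using that(2) x0(2) by (auto simp: key_def)
      have s: "state x i = state z i"
        unfolding k(1) using z(3) by (intro state_eqI) (auto simp: i_def)
      then have "splice i x z \<in> fibre y"
        using splice_same_fibre that(1) z(1) by blast
      moreover have "splice i x z j = x j" if "j \<le> 0" for j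
        using splice_left[OF s] that by (simp add: i_def)
      moreover have "splice i x z j = rep x j" if "j \<ge> n'" for j
        using that z(2,4) \<open>n' \<ge> n\<close> radius k(2) by (simp add: splice_apply i_def)
      ultimately show ?thesis unfolding good_def by blast
    qed
    then show ?thesis unfolding eventually_at_top_linorder by blast
  qed
  ultimately have "eventually (\<lambda>n. \<forall>p\<in>key ` fibre y. \<forall>x\<in>fibre y. key x = p \<longrightarrow> good n x) at_top"
    by (intro eventually_ball_finite) auto
  then have "eventually (\<lambda>n. \<forall>x\<in>fibre y. good n x) at_top"
    by (rule eventually_mono) blast
  then have "eventually (\<lambda>n. (\<forall>x\<in>fibre y. good n x) \<and> n \<ge> 1) at_top"
    using eventually_ge_at_top eventually_conj by blast
  then obtain n where n: "\<And>x. x \<in> fibre y \<Longrightarrow> good n x" "n \<ge> 1"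
    by (auto dest!: eventually_happens)
  define M where "M = (\<lambda>\<rho>. state \<rho> n) ` R"
  have reroute: "\<exists>z\<in>fibre y. \<exists>N. (\<forall>j\<le>0. z j = x j) \<and> (\<forall>j\<ge>N. z j = x j) \<and> state z n \<in> M \<and> N \<ge> n + int K"
    if x: "x \<in> fibre y" for x
  proof -
    obtain z where z: "z \<in> fibre y" "\<forall>j\<le>0. z j = x j" "\<forall>j\<ge>n. z j = rep x j"
      using n(1)[OF x] unfolding good_def by blast
    obtain z' N where z': "z' \<in> fibre y" "N > n + int K" "\<And>j. j \<le> n + int K \<Longrightarrow> z' j = rep x j" "\<And>j. j \<ge> N \<Longrightarrow> z' j = x j"
      by (rule right_transitionE[OF rep(3)[OF x] repF[OF x], where m = "n + int K"]) blast
    have s: "state z n = state z' n" "state z n = state (rep x) n"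
      using z z' by (auto intro!: state_eqI)
    have "splice n z z' \<in> fibre y"
      using splice_same_fibre z(1) z'(1) s by blast
    moreover have "state (rep x) n \<in> M"
      using rep(1)[OF x] by (simp add: M_def)
    then have "state (splice n z z') n \<in> M"
      using s by (simp add: state_splice)
    ultimately show ?thesis
      using z z' n(2) by (intro bexI[of _ "splice n z z'"] exI[of _ N]) (auto simp: splice_apply)
  qed
  have "\<exists>l. routing y (- l) l n M"
  proof (rule ccontr)
    assume no: "\<nexists>l. routing y (- l) l n M"
    \<comment> \<open>A sequence of points that cannot be rerouted on growing windows clusters at a point that can.\<close>
    define l where "l = (\<lambda>k::nat. int k + n + int K)"
    have "\<exists>x\<in>X. (\<forall>j. - l k \<le> j \<and> j \<le> l k \<longrightarrow> \<pi> x j = y j) \<and>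
       \<not> (\<exists>z\<in>fibre (\<pi> x). (\<forall>j. j \<le> - l k \<or> l k \<le> j \<longrightarrow> z j = x j) \<and> state z n \<in> M)" for k
    proof -
      have "\<not> routing y (- l k) (l k) n M" using no by blast
      moreover have "- l k \<le> n" "n + int K \<le> l k" "finite M" using n(2) finR by (auto simp: l_def M_def)
      ultimately show ?thesis unfolding routing_def by blast
    qed
    then obtain s where s: "\<And>k. s k \<in> X" "\<And>k j. - l k \<le> j \<Longrightarrow> j \<le> l k \<Longrightarrow> \<pi> (s k) j = y j"
      "\<And>k z. \<lbrakk>z \<in> fibre (\<pi> (s k)); \<And>j. j \<le> - l k \<or> l k \<le> j \<Longrightarrow> z j = s k j\<rbrakk> \<Longrightarrow> state z n \<notin> M"
      by metis
    have "agree (int k) (\<pi> (s k)) y" for k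
      using s(2)[of k] n(2) by (auto simp: agree_def l_def)
    then obtain x where x: "x \<in> fibre y" "\<And>N::nat. \<exists>k\<ge>N. agree (int N) (s k) x"
      using fibre_cluster_point[of s, OF s(1)] by blast
    obtain z N where z: "z \<in> fibre y" "\<forall>j\<le>0. z j = x j" "\<forall>j\<ge>N. z j = x j" "state z n \<in> M" "N \<ge> n + int K"
      using reroute[OF x(1)] by blast
    obtain k where k: "k \<ge> nat N + 2 * K" "agree (int (nat N + 2 * K)) (s k) x" using x(2) by blast
    have N: "N > 0" "N + 2 * int K \<le> int k" using k(1) z(5) n(2) by auto
    have e: "s k j = x j" if "\<bar>j\<bar> \<le> N + 2 * int K" for j
      using agreeD[OF k(2)] that N by simp
    have s1: "state (s k) i = state z i"
      using e z(2) N by (intro state_eqI) (auto simp: i_def)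
    \<comment> \<open>z2 transplants the detour z of the cluster point x into s k.\<close>
    define z1 where "z1 = splice i (s k) z"
    have z1: "z1 \<in> fibre (splice (i + int r) (\<pi> (s k)) y)"
      unfolding z1_def using s(1) z(1) s1 by (intro splice_fibre) (auto simp: fibre_def splice_apply)
    have "state z1 N = state z N" using s1 z(5) n(2) radius by (simp add: z1_def state_splice i_def)
    also have "state z N = state (s k) N" using e z(3) N by (intro state_eqI) auto
    finally have s2: "state z1 N = state (s k) N" .
    define z2 where "z2 = splice N z1 (s k)"
    have "z2 \<in> fibre (\<pi> (s k))"
      unfolding z2_def
    proof (rule splice_fibre)
      show "\<pi> z1 j = \<pi> (s k) j" if "j < N + int r" for j
        using fibreD(2)[OF z1] s(2)[of k j] that N radius n(2) by (auto simp: splice_apply i_def l_def)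
    qed (use z1 s(1) s2 in \<open>auto simp: fibre_def\<close>)
    moreover have "z2 j = s k j" if "j \<le> - l k \<or> l k \<le> j" for j
      using that N n(2) radius by (auto simp: z2_def z1_def splice_apply l_def i_def)
    moreover have "state z2 n \<in> M"
      using z(4,5) n(2) radius s1 s2 by (simp add: z2_def z1_def state_splice i_def)
    ultimately show False using s(3) by blast
  qed
  moreover have "card M \<le> num_right_classes X \<pi> y"
    using finR card_image_le[of R] by (auto simp: M_def)
  ultimately show ?thesis by blast
qed

lemma depth_le_num_right_classes: "y \<in> Y \<Longrightarrow> depth \<le> num_right_classes X \<pi> y"
  using routing_from_right_classes depth_le by (meson le_trans)

text \<open>The colour of a point is the state in which it has been routed through \<open>M\<close>.\<close>

lemma routing_colouring:
  assumes R: "routing y a b n M" and m: "m \<le> a"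
  shows "\<exists>g. g ` fibre y \<subseteq> M \<and>
    (\<forall>x\<in>fibre y. \<forall>x'\<in>fibre y. g x = g x' \<longrightarrow> (\<exists>z. right_bridge X \<pi> m x x' z))"
proof -
  have ab: "a \<le> n" "n + int K \<le> b" using R by (auto simp: routing_def)
  have "\<exists>w\<in>fibre y. (\<forall>j. j \<le> a \<or> b \<le> j \<longrightarrow> w j = x j) \<and> state w n \<in> M" if "x \<in> fibre y" for x
    using routingE[OF R, of x] fibreD[OF that] by metis
  then obtain w where w: "\<And>x. x \<in> fibre y \<Longrightarrow> w x \<in> fibre y"
    "\<And>x j. x \<in> fibre y \<Longrightarrow> j \<le> a \<or> b \<le> j \<Longrightarrow> w x j = x j" "\<And>x. x \<in> fibre y \<Longrightarrow> state (w x) n \<in> M"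
    by metis
  have "right_bridge X \<pi> m x x' (splice n (w x) (w x'))"
    if x: "x \<in> fibre y" "x' \<in> fibre y" "state (w x) n = state (w x') n" for x x'
  proof -
    have "splice n (w x) (w x') \<in> fibre y"
      using w(1) x by (intro splice_same_fibre) auto
    moreover have "splice n (w x) (w x') j = x j" if "j \<le> m" for j
      using splice_left[OF x(3), of j] w(2)[OF x(1), of j] ab m that radius by simp
    moreover have "splice n (w x) (w x') j = x' j" if "j \<ge> b" for j
      using w(2)[OF x(2), of j] ab that by (simp add: splice_apply)
    ultimately show ?thesis
      unfolding right_bridge_fibre[OF x(1)] using ab m radius by (intro conjI exI[of _ b]) auto
  qed
  then show ?thesis
    using w(3) by (intro exI[of _ "\<lambda>x. state (w x) n"]) blast
qed

text \<open>The point repeats a minimal routing periodically, and so there is a colouring by its \<open>depth\<close> states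
  beyond any coordinate.\<close>

lemma num_right_classes_attains_depth:
  assumes "Y \<noteq> {}"
  obtains y where "y \<in> Y" "num_right_classes X \<pi> y \<le> depth"
proof -
  obtain y a b n M where mr: "minimal_routing y a b n M"
    using minimal_routing_exists[OF assms] .
  note D = minimal_routingD[OF mr]
  obtain z T where z: "z \<in> Y" "T > 0" "\<And>i j. \<lbrakk>a \<le> j; j \<le> b\<rbrakk> \<Longrightarrow> z (j + int i * T) = y j"
    using cod.recurrent_point[OF D(1), of a b] D(4,5) by auto
  have "num_right_classes X \<pi> z \<le> depth"
  proof (rule right_classes_le_colours(2))
    fix m
    define i where "i = nat \<bar>m - a\<bar>"
    define t where "t = int i * T"
    have "m \<le> a + int i" by (simp add: i_def)
    also have "\<dots> \<le> a + t" using z(2) by (simp add: t_def mult_le_cancel_left1)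
    finally have m: "m \<le> a + t" .
    have "minimal_routing (translate (- t) y) (a + t) (b + t) (n + t) M"
      using minimal_routing_translate[OF mr, of "- t"] by simp
    then have mrz: "minimal_routing z (a + t) (b + t) (n + t) M"
      using z(1) z(3)[of "j - t" i for j] by (elim minimal_routing_cong) (auto simp: t_def)
    show "\<exists>g :: (int \<Rightarrow> 'a) \<Rightarrow> 'a list. \<exists>S. finite S \<and> card S \<le> depth \<and> g ` fibre z \<subseteq> S \<and>
      (\<forall>x\<in>fibre z. \<forall>x'\<in>fibre z. g x = g x' \<longrightarrow> (\<exists>w. right_bridge X \<pi> m x x' w))"
      using routing_colouring[OF minimal_routingD(2)[OF mrz] m] D(3,6) by force
  qed
  then show ?thesis using that z(1) by blast
qed

lemma constant_iff_depth:
  "constant_class_to_one X Y \<pi> \<longleftrightarrow> (\<forall>y\<in>Y. num_right_classes X \<pi> y = depth)"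
proof (cases "Y = {}")
  case False
  obtain y0 where y0: "y0 \<in> Y" "num_right_classes X \<pi> y0 \<le> depth"
    using num_right_classes_attains_depth[OF False] .
  have "class_degree X Y \<pi> = depth"
    unfolding class_degree_def
  proof (rule antisym)
    show "(INF y\<in>Y. num_right_classes X \<pi> y) \<le> depth"
      using y0 by (meson cINF_lower2 bdd_below_bot)
    show "depth \<le> (INF y\<in>Y. num_right_classes X \<pi> y)"
      using depth_le_num_right_classes False by (intro cINF_greatest) auto
  qed
  then show ?thesis by (simp add: constant_class_to_one_def)
qed (simp add: constant_class_to_one_def)

section \<open>Constant-class-to-one codes are bi-class-closing\<close>

text \<open>A point with exactly \<open>depth\<close> classes has a minimal routing. Points that have none in larger and larger
  windows around \<open>0\<close> would cluster at a point that has none at all.\<close>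

lemma minimal_routings_dense:
  assumes const: "\<And>y. y \<in> Y \<Longrightarrow> num_right_classes X \<pi> y = depth"
  obtains L where "\<And>y t. y \<in> Y \<Longrightarrow> \<exists>a b n M. t - L \<le> a \<and> b \<le> t + L \<and> minimal_routing y a b n M"
proof -
  have "\<exists>L::nat. \<forall>y\<in>Y. \<exists>a b n M. - int L \<le> a \<and> b \<le> int L \<and> minimal_routing y a b n M"
  proof (rule ccontr)
    assume "\<not> ?thesis"
    then obtain s where s: "\<And>L::nat. s L \<in> Y"
      "\<And>L a b n M. - int L \<le> a \<Longrightarrow> b \<le> int L \<Longrightarrow> \<not> minimal_routing (s L) a b n M"
      by metis
    obtain y where y: "\<And>N::nat. \<exists>k\<ge>N. agree (int N) (s k) y"
      using sequence_cluster_point[of s] by blast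
    have yY: "y \<in> Y" using cod.limit y s(1) by metis
    obtain a b n M where R: "routing y a b n M" "card M \<le> depth"
      using routing_from_right_classes[OF yY] const[OF yY] by auto
    then have mr: "minimal_routing y a b n M"
      using depth_le[OF yY R(1)] yY by (simp add: minimal_routing_def)
    define N where "N = nat (\<bar>a\<bar> + \<bar>b\<bar>)"
    obtain k where k: "k \<ge> N" "agree (int N) (s k) y" using y by blast
    have "minimal_routing (s k) a b n M"
      by (rule minimal_routing_cong[OF mr s(1)]) (auto intro!: agreeD[OF k(2)] simp: N_def)
    then show False using s(2)[of k a b] k(1) by (auto simp: N_def)
  qed
  then obtain L :: nat where L: "\<And>y. y \<in> Y \<Longrightarrow> \<exists>a b n M. - int L \<le> a \<and> b \<le> int L \<and> minimal_routing y a b n M"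
    by blast
  have "\<exists>a b n M. t - int L \<le> a \<and> b \<le> t + int L \<and> minimal_routing y a b n M" if yY: "y \<in> Y" for y t
  proof -
    obtain a b n M where "- int L \<le> a" "b \<le> int L" "minimal_routing (translate t y) a b n M"
      using L[OF cod.translate[OF yY, of t]] by blast
    then show ?thesis
      using minimal_routing_translate[of "translate t y" a b n M "- t"]
      by (intro exI[of _ "a + t"] exI[of _ "b + t"] exI[of _ "n + t"] exI[of _ M]) auto
  qed
  then show ?thesis using that by blast
qed

text \<open>Both points are routed through a minimal routing to the right of \<open>m\<close> and of the coordinate up to which
  they agree. By rigidity they do so in the same state, where the one can be continued as the other.\<close>

lemma constant_imp_right_class_closing:
  assumes "constant_class_to_one X Y \<pi>"
  shows "right_class_closing X \<pi>"
proof -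
  have const: "\<And>y. y \<in> Y \<Longrightarrow> num_right_classes X \<pi> y = depth"
    using assms by (simp add: constant_iff_depth)
  obtain L where L: "\<And>y t. y \<in> Y \<Longrightarrow> \<exists>a b n M. t - L \<le> a \<and> b \<le> t + L \<and> minimal_routing y a b n M"
    using minimal_routings_dense[OF const] by blast
  have tr: "right_transition X \<pi> x x'"
    if x: "x \<in> X" "x' \<in> X" "left_asymptotic x x'" "\<pi> x = \<pi> x'" for x x'
    unfolding right_transition_def
  proof
    fix m
    obtain p where p: "\<forall>j\<le>p. x j = x' j" using x(3) by (auto simp: left_asymptotic_def)
    define i where "i = p - int K"
    define y where "y = \<pi> x"
    have xy: "x \<in> fibre y" "x' \<in> fibre y" using x by (auto simp: y_def fibre_def)
    obtain a b n M where mr: "max m i + L - L \<le> a" "minimal_routing y a b n M"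
      using L[of y "max m i + L"] image_in[OF x(1)] by (auto simp: y_def)
    note D = minimal_routingD[OF mr(2)]
    obtain w where w: "w \<in> fibre y" "\<And>j. j \<le> a \<or> b \<le> j \<Longrightarrow> w j = x j" "state w n \<in> M"
      using routingE[OF D(2) x(1)] xy(1) by (metis fibreD(2))
    obtain w' where w': "w' \<in> fibre y" "\<And>j. j \<le> a \<or> b \<le> j \<Longrightarrow> w' j = x' j" "state w' n \<in> M"
      using routingE[OF D(2) x(2)] xy(2) by (metis fibreD(2))
    have "state w (i - int K) = state w' (i - int K)"
      using w(2) w'(2) mr(1) p by (intro state_eqI) (auto simp: i_def)
    then have s: "state w n = state w' n"
      using minimal_routing_state_forward[OF mr(2) w(1) w'(1) _ _ w(3) w'(3)] mr(1) by simp
    have "splice n w w' \<in> fibre y"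
      using splice_same_fibre[OF w(1) w'(1) s] .
    moreover have "splice n w w' j = x j" if "j \<le> m" for j
      using splice_left[OF s, of j] w(2)[of j] that mr(1) D(4) radius by simp
    moreover have "splice n w w' j = x' j" if "b \<le> j" for j
      using w'(2)[of j] that D(5) by (simp add: splice_apply)
    ultimately show "\<exists>z. right_bridge X \<pi> m x x' z"
      unfolding right_bridge_fibre[OF xy(1)] using mr(1) D(4,5) radius
      by (intro exI[of _ "splice n w w'"] conjI exI[of _ b]) auto
  qed
  have sym: "left_asymptotic x' x" if "left_asymptotic x x'" for x x' :: "int \<Rightarrow> 'a"
    using that unfolding left_asymptotic_def by metis
  show ?thesis
    unfolding right_class_closing_def right_equivalent_def using tr sym by metis
qed

lemma constant_imp_left_class_closing:
  assumes "constant_class_to_one X Y \<pi>"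
  shows "left_class_closing X \<pi>"
proof -
  have const: "\<And>y. y \<in> Y \<Longrightarrow> num_right_classes X \<pi> y = depth"
    using assms by (simp add: constant_iff_depth)
  obtain L where L: "\<And>y t. y \<in> Y \<Longrightarrow> \<exists>a b n M. t - L \<le> a \<and> b \<le> t + L \<and> minimal_routing y a b n M"
    using minimal_routings_dense[OF const] by blast
  have tr: "left_transition X \<pi> x x'"
    if x: "x \<in> X" "x' \<in> X" "right_asymptotic x x'" "\<pi> x = \<pi> x'" for x x'
    unfolding left_transition_def
  proof
    fix m
    obtain i where i: "\<forall>j\<ge>i. x j = x' j" using x(3) by (auto simp: right_asymptotic_def)
    define y where "y = \<pi> x"
    have xy: "x \<in> fibre y" "x' \<in> fibre y" using x by (auto simp: y_def fibre_def)
    obtain a b n M where mr: "b \<le> min m i - L + L" "minimal_routing y a b n M"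
      using L[of y "min m i - L"] image_in[OF x(1)] by (auto simp: y_def)
    note D = minimal_routingD[OF mr(2)]
    obtain w where w: "w \<in> fibre y" "\<And>j. j \<le> a \<or> b \<le> j \<Longrightarrow> w j = x j" "state w n \<in> M"
      using routingE[OF D(2) x(1)] xy(1) by (metis fibreD(2))
    obtain w' where w': "w' \<in> fibre y" "\<And>j. j \<le> a \<or> b \<le> j \<Longrightarrow> w' j = x' j" "state w' n \<in> M"
      using routingE[OF D(2) x(2)] xy(2) by (metis fibreD(2))
    have "state w i = state w' i"
      using w(2) w'(2) mr(1) i by (intro state_eqI) auto
    then have s: "state w' n = state w n"
      using minimal_routing_state_backward[OF mr(2) w(1) w'(1) _ _ w(3) w'(3)] mr(1) by simp
    have "splice n w' w \<in> fibre y"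
      using splice_same_fibre[OF w'(1) w(1) s] .
    moreover have "splice n w' w j = x j" if "j \<ge> m" for j
      using w(2)[of j] that mr(1) D(5) by (simp add: splice_apply)
    moreover have "splice n w' w j = x' j" if "j \<le> a" for j
      using splice_left[OF s, of j] w'(2)[of j] that D(4) radius by simp
    ultimately show "\<exists>z. left_bridge X \<pi> m x x' z"
      unfolding left_bridge_fibre[OF xy(1)] using mr(1) D(4,5) radius
      by (intro exI[of _ "splice n w' w"] conjI exI[of _ a]) auto
  qed
  have sym: "right_asymptotic x' x" if "right_asymptotic x x'" for x x' :: "int \<Rightarrow> 'a"
    using that unfolding right_asymptotic_def by metis
  show ?thesis
    unfolding left_class_closing_def left_equivalent_def using tr sym by metis
qed

section \<open>Bi-class-closing codes are constant-class-to-one\<close>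

lemma mirror_class_code: "class_code (mirror ` X) (mirror ` Y) K (mirror \<circ> \<pi> \<circ> mirror) r"
proof (intro class_code.intro class_code_axioms.intro)
  show "irreducible_sft (mirror ` X) K" "irreducible_sft (mirror ` Y) K"
    by (rule dom.mirror_irreducible_sft cod.mirror_irreducible_sft)+
  show "(mirror \<circ> \<pi> \<circ> mirror) ` mirror ` X = mirror ` Y"
    unfolding image[symmetric] by (simp add: image_image)
  show "(mirror \<circ> \<pi> \<circ> mirror) (translate t x) = translate t ((mirror \<circ> \<pi> \<circ> mirror) x)"
    if "x \<in> mirror ` X" for x t
    using that translate by (simp add: mirror_image_iff mirror_translate)
  show "(mirror \<circ> \<pi> \<circ> mirror) x j = (mirror \<circ> \<pi> \<circ> mirror) x' j"
    if x: "x \<in> mirror ` X" "x' \<in> mirror ` X" and eq: "\<And>k. \<bar>k - j\<bar> \<le> int r \<Longrightarrow> x k = x' k" for x x' j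
  proof -
    have "\<pi> (mirror x) (- j) = \<pi> (mirror x') (- j)"
      using x eq by (intro local_rule) (auto simp: mirror_image_iff)
    then show ?thesis by simp
  qed
  show "2 * r + 1 \<le> K" by (rule radius)
qed

lemma mirror_right_class_closing:
  assumes "left_class_closing X \<pi>"
  shows "right_class_closing (mirror ` X) (mirror \<circ> \<pi> \<circ> mirror)"
proof -
  have tr: "right_transition (mirror ` X) (mirror \<circ> \<pi> \<circ> mirror) x x'"
    if x: "x \<in> mirror ` X" "x' \<in> mirror ` X" "left_asymptotic x x'"
      "(mirror \<circ> \<pi> \<circ> mirror) x = (mirror \<circ> \<pi> \<circ> mirror) x'" for x x'
    unfolding right_transition_def
  proof
    fix m
    obtain p where "\<forall>j\<le>p. x j = x' j" using x(3) by (auto simp: left_asymptotic_def)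
    then have "right_asymptotic (mirror x) (mirror x')"
      unfolding right_asymptotic_def by (intro exI[of _ "- p"]) auto
    then have "left_transition X \<pi> (mirror x) (mirror x')"
      using assms x(1,2,4) unfolding left_class_closing_def left_equivalent_def
      by (simp add: mirror_image_iff mirror_inj)
    then obtain z where "left_bridge X \<pi> (- m) (mirror x) (mirror x') z"
      unfolding left_transition_def by blast
    then obtain n where z: "z \<in> X" "\<pi> z = \<pi> (mirror x)" "n < - m"
      "\<forall>j\<le>n. z j = x' (- j)" "\<forall>j\<ge>- m. z j = x (- j)"
      by (auto simp: left_bridge_def)
    have "right_bridge (mirror ` X) (mirror \<circ> \<pi> \<circ> mirror) m x x' (mirror z)"
      unfolding right_bridge_def using z by (auto intro!: exI[of _ "- n"])
    then show "\<exists>z. right_bridge (mirror ` X) (mirror \<circ> \<pi> \<circ> mirror) m x x' z" by blast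
  qed
  have sym: "left_asymptotic x' x" if "left_asymptotic x x'" for x x' :: "int \<Rightarrow> 'a"
    using that unfolding left_asymptotic_def by metis
  show ?thesis
    unfolding right_class_closing_def right_equivalent_def using tr sym by simp
qed

text \<open>A uniform version of right class-closing, for points whose images agree only up to \<open>L\<close>: the bridge
  follows \<open>x\<close> one coordinate further than \<open>x\<close> and \<open>x'\<close> are known to agree. Counterexamples for growing
  \<open>L\<close> would cluster at two left asymptotic points of one fibre, and a bridge between these can be transplanted
  into a counterexample.\<close>

lemma right_closing_step:
  assumes closing: "right_class_closing X \<pi>"
  shows "\<exists>L::nat. L \<ge> 1 \<and> (\<forall>x\<in>X. \<forall>x'\<in>X.
    (\<forall>j\<le>0. x j = x' j) \<longrightarrow> (\<forall>j\<le>int L. \<pi> x j = \<pi> x' j) \<longrightarrow>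
      (\<exists>z\<in>fibre (\<pi> x'). (\<forall>j\<le>1. z j = x j) \<and> (\<forall>j\<ge>int L. z j = x' j)))"
proof (rule ccontr)
  assume no: "\<not> ?thesis"
  have "\<exists>x x'. x \<in> X \<and> x' \<in> X \<and> (\<forall>j\<le>0. x j = x' j) \<and> (\<forall>j\<le>int k + 1. \<pi> x j = \<pi> x' j) \<and>
      \<not> (\<exists>z\<in>fibre (\<pi> x'). (\<forall>j\<le>1. z j = x j) \<and> (\<forall>j\<ge>int k + 1. z j = x' j))" for k :: nat
    using no[unfolded not_ex, rule_format, of "Suc k"] by (simp add: add.commute) blast
  then obtain s s' where s: "\<And>k. s k \<in> X" "\<And>k. s' k \<in> X" "\<And>k j. j \<le> 0 \<Longrightarrow> s k j = s' k j"
    "\<And>k j. j \<le> int k + 1 \<Longrightarrow> \<pi> (s k) j = \<pi> (s' k) j"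
    and s_no: "\<And>k z. \<lbrakk>z \<in> fibre (\<pi> (s' k)); \<And>j. j \<le> 1 \<Longrightarrow> z j = s k j; \<And>j. j \<ge> int k + 1 \<Longrightarrow> z j = s' k j\<rbrakk> \<Longrightarrow> False"
    by metis
  \<comment> \<open>Passing to sequences of pairs makes both sequences cluster along the same indices.\<close>
  obtain w where w: "\<And>N::nat. \<exists>k\<ge>N. agree (int N) (\<lambda>j. (s k j, s' k j)) w"
    using sequence_cluster_point[of "\<lambda>k j. (s k j, s' k j)"] by blast
  define x x' where "x = fst \<circ> w" and "x' = snd \<circ> w"
  have lim: "\<exists>k\<ge>N. agree (int N) (s k) x \<and> agree (int N) (s' k) x'" for N
  proof -
    obtain k where k: "k \<ge> N" "agree (int N) (\<lambda>j. (s k j, s' k j)) w" using w by blast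
    have "w j = (s k j, s' k j)" if "\<bar>j\<bar> \<le> int N" for j
      using agreeD[OF k(2) that] by simp
    then show ?thesis
      using k(1) by (intro exI[of _ k]) (simp add: agree_def x_def x'_def)
  qed
  have X: "x \<in> X" "x' \<in> X"
    using dom.limit lim s(1,2) by metis+
  have "x j = x' j" if "j \<le> 0" for j
  proof -
    obtain k where "agree (int (nat \<bar>j\<bar>)) (s k) x" "agree (int (nat \<bar>j\<bar>)) (s' k) x'" using lim by blast
    then show ?thesis using s(3)[OF that, of k] agreeD[of _ "s k" x j] agreeD[of _ "s' k" x' j] by simp
  qed
  then have "left_asymptotic x x'" by (auto simp: left_asymptotic_def)
  moreover have loc: "\<pi> (s k) j = \<pi> x j \<and> \<pi> (s' k) j = \<pi> x' j"
    if "agree (int N) (s k) x" "agree (int N) (s' k) x'" "\<bar>j\<bar> + int r \<le> int N" for k N j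
    using that X s(1,2) by (auto intro!: local_rule intro: agreeD)
  have eq: "\<pi> x = \<pi> x'"
  proof
    fix j
    define N where "N = nat \<bar>j\<bar> + r"
    obtain k where "k \<ge> N" "agree (int N) (s k) x" "agree (int N) (s' k) x'" using lim by blast
    moreover from this have "j \<le> int k + 1" unfolding N_def by linarith
    moreover have "\<bar>j\<bar> + int r \<le> int N" by (simp add: N_def)
    ultimately show "\<pi> x j = \<pi> x' j"
      using loc s(4) by metis
  qed
  ultimately have "right_transition X \<pi> x x'"
    using closing X by (auto simp: right_class_closing_def right_equivalent_def)
  then obtain z n where z: "z \<in> fibre (\<pi> x)" "n > int K" "\<And>j. j \<le> int K \<Longrightarrow> z j = x j" "\<And>j. j \<ge> n \<Longrightarrow> z j = x' j"
    by (rule right_transitionE[where y = "\<pi> x" and m = "int K"]) (use X in \<open>auto simp: fibre_def\<close>)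
  define N where "N = nat n + 2 * K"
  obtain k where k: "k \<ge> N" "agree (int N) (s k) x" "agree (int N) (s' k) x'" using lim by blast
  have N: "int N = n + 2 * int K" "n > 0" using z(2) by (auto simp: N_def)
  have e: "state (s k) 1 = state z 1"
    using z(3) agreeD[OF k(2)] N by (intro state_eqI) auto
  \<comment> \<open>The bridge was chosen to follow x up to K, so that it shares with s k the state at 1.\<close>
  define z1 where "z1 = splice 1 (s k) z"
  have z1: "z1 \<in> fibre (splice (1 + int r) (\<pi> (s k)) (\<pi> x))"
    unfolding z1_def using s(1) z(1) e by (intro splice_fibre) (auto simp: fibre_def splice_apply)
  have "state z1 n = state z n" using e N(2) z(2) radius by (auto simp: z1_def state_splice)
  also have "state z n = state (s' k) n"
    using z(4) agreeD[OF k(3)] N by (intro state_eqI) auto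
  finally have e2: "state z1 n = state (s' k) n" .
  have "splice n z1 (s' k) \<in> fibre (\<pi> (s' k))"
  proof (rule splice_fibre)
    show "\<pi> z1 j = \<pi> (s' k) j" if "j < n + int r" for j
    proof (cases "j < 1 + int r")
      case True
      then show ?thesis using fibreD(2)[OF z1] s(4)[of j k] k(1) N that radius by (simp add: splice_apply)
    next
      case False
      then show ?thesis using fibreD(2)[OF z1] loc[OF k(2,3), of j] eq N that radius by (simp add: splice_apply)
    qed
  qed (use z1 s(2) e2 in \<open>auto simp: fibre_def\<close>)
  moreover have "splice n z1 (s' k) j = s k j" if "j \<le> 1" for j
    using splice_left[OF e2, of j] splice_left[OF e, of j] that N(2) radius by (simp add: z1_def)
  moreover have "splice n z1 (s' k) j = s' k j" if "j \<ge> int k + 1" for j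
    using that k(1) N by (simp add: splice_apply)
  ultimately show False using s_no by blast
qed

text \<open>The delay \<open>L\<close> does not depend on how long ago the points have parted. The departure from \<open>x\<close> is
  postponed step by step: a point that leaves \<open>x\<close> after \<open>m\<close> can be replaced by one that leaves it after
  \<open>m + 1\<close> and rejoins it within \<open>L\<close>. Compactness alone would only give a delay for each distance.\<close>

lemma right_closing_uniform:
  assumes closing: "right_class_closing X \<pi>"
  shows "\<exists>L::nat. L \<ge> 1 \<and> (\<forall>x\<in>X. \<forall>x'\<in>X. \<forall>p m. p \<le> m \<longrightarrow>
    (\<forall>j\<le>p. x j = x' j) \<longrightarrow> (\<forall>j\<le>m + int L. \<pi> x j = \<pi> x' j) \<longrightarrow>
      (\<exists>z\<in>fibre (\<pi> x'). (\<forall>j\<le>m. z j = x j) \<and> (\<forall>j\<ge>m + int L. z j = x' j)))"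
proof -
  obtain L :: nat where L: "L \<ge> 1" "\<forall>x\<in>X. \<forall>x'\<in>X.
    (\<forall>j\<le>0. x j = x' j) \<longrightarrow> (\<forall>j\<le>int L. \<pi> x j = \<pi> x' j) \<longrightarrow>
      (\<exists>z\<in>fibre (\<pi> x'). (\<forall>j\<le>1. z j = x j) \<and> (\<forall>j\<ge>int L. z j = x' j))"
    using right_closing_step[OF closing] by blast
  have steps: "\<exists>z\<in>fibre (\<pi> x'). (\<forall>j\<le>p + int n. z j = x j) \<and> (\<forall>j\<ge>p + int n + int L. z j = x' j)"
    if x: "x \<in> X" "x' \<in> X" "\<And>j. j \<le> p \<Longrightarrow> x j = x' j" and "\<And>j. j \<le> p + int n + int L \<Longrightarrow> \<pi> x j = \<pi> x' j"
    for x x' p n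
    using that(4)
  proof (induction n)
    case 0
    then show ?case using x by (intro bexI[of _ x']) (auto simp: fibre_def)
  next
    case (Suc n)
    obtain z where z: "z \<in> fibre (\<pi> x')" "\<forall>j\<le>p + int n. z j = x j" "\<forall>j\<ge>p + int n + int L. z j = x' j"
      using Suc by auto
    note zD = fibreD[OF z(1)]
    let ?t = "p + int n"
    have "\<exists>v\<in>fibre (\<pi> (translate ?t z)). (\<forall>j\<le>1. v j = translate ?t x j) \<and> (\<forall>j\<ge>int L. v j = translate ?t z j)"
    proof (rule L(2)[rule_format])
      show "translate ?t x \<in> X" "translate ?t z \<in> X" using dom.translate x(1) zD(1) by blast+
      show "\<pi> (translate ?t x) j = \<pi> (translate ?t z) j" if "j \<le> int L" for j
        unfolding translate[OF x(1)] translate[OF zD(1)] zD(2) translate_apply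
        by (rule Suc.prems) (use that in simp)
    qed (use z(2) in simp)
    then obtain v where v: "v \<in> fibre (\<pi> (translate ?t z))" "\<forall>j\<le>1. v j = x (j + ?t)" "\<forall>j\<ge>int L. v j = z (j + ?t)"
      by auto
    have "translate (- ?t) v \<in> fibre (\<pi> x')"
      using fibre_translate[OF v(1), of "- ?t"] zD by (simp add: translate)
    moreover have "translate (- ?t) v j = x j" if "j \<le> p + int (Suc n)" for j
    proof -
      have "j - ?t \<le> 1" using that by simp
      then show ?thesis
        using v(2)[rule_format, of "j - ?t"] by (simp only: translate_apply add_uminus_conv_diff diff_add_cancel)
    qed
    moreover have "translate (- ?t) v j = x' j" if "j \<ge> p + int (Suc n) + int L" for j
    proof -
      have "int L \<le> j - ?t" using that by simp
      then have "v (j - ?t) = z j"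
        using v(3)[rule_format, of "j - ?t"] by (simp only: diff_add_cancel)
      then show ?thesis
        using z(3) that by (simp only: translate_apply add_uminus_conv_diff)
    qed
    ultimately show ?case by blast
  qed
  have "\<exists>z\<in>fibre (\<pi> x'). (\<forall>j\<le>m. z j = x j) \<and> (\<forall>j\<ge>m + int L. z j = x' j)"
    if "x \<in> X" "x' \<in> X" "p \<le> m" "\<And>j. j \<le> p \<Longrightarrow> x j = x' j" "\<And>j. j \<le> m + int L \<Longrightarrow> \<pi> x j = \<pi> x' j"
    for x x' p m
    using steps[of x x' p "nat (m - p)"] that by simp
  then show ?thesis using L(1) by (intro exI[of _ L]) auto
qed

lemma left_closing_uniform:
  assumes closing: "left_class_closing X \<pi>"
  shows "\<exists>L::nat. L \<ge> 1 \<and> (\<forall>y. \<forall>x\<in>fibre y. \<forall>x'\<in>fibre y. \<forall>p m. m \<le> p \<longrightarrow> (\<forall>j\<ge>p. x j = x' j) \<longrightarrow>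
      (\<exists>z\<in>fibre y. (\<forall>j\<ge>m. z j = x j) \<and> (\<forall>j\<le>m - int L. z j = x' j)))"
proof -
  interpret mir: class_code "mirror ` X" "mirror ` Y" K "mirror \<circ> \<pi> \<circ> mirror" r
    by (rule mirror_class_code)
  let ?\<pi> = "mirror \<circ> \<pi> \<circ> mirror"
  obtain L :: nat where L: "L \<ge> 1" "\<forall>x\<in>mirror ` X. \<forall>x'\<in>mirror ` X. \<forall>p m. p \<le> m \<longrightarrow>
    (\<forall>j\<le>p. x j = x' j) \<longrightarrow> (\<forall>j\<le>m + int L. ?\<pi> x j = ?\<pi> x' j) \<longrightarrow>
      (\<exists>z\<in>mir.fibre (?\<pi> x'). (\<forall>j\<le>m. z j = x j) \<and> (\<forall>j\<ge>m + int L. z j = x' j))"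
    using mir.right_closing_uniform[OF mirror_right_class_closing[OF closing]] by blast
  have "\<exists>z\<in>fibre y. (\<forall>j\<ge>m. z j = x j) \<and> (\<forall>j\<le>m - int L. z j = x' j)"
    if x: "x \<in> fibre y" "x' \<in> fibre y" "m \<le> p" "\<And>j. j \<ge> p \<Longrightarrow> x j = x' j" for x x' y p m
  proof -
    have "\<exists>z\<in>mir.fibre ((mirror \<circ> \<pi> \<circ> mirror) (mirror x')).
        (\<forall>j\<le>- m. z j = mirror x j) \<and> (\<forall>j\<ge>- m + int L. z j = mirror x' j)"
      
    proof (rule L(2)[rule_format, of _ _ "- p"])
      show "mirror x \<in> mirror ` X" "mirror x' \<in> mirror ` X" using x fibreD(1) by blast+
      show "?\<pi> (mirror x) j = ?\<pi> (mirror x') j" for j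
        unfolding comp_apply mirror_mirror fibreD(2)[OF x(1)] fibreD(2)[OF x(2)] ..
    qed (use x in auto)
    then obtain z where z: "mirror z \<in> X" "\<pi> (mirror z) = y" "\<forall>j\<le>- m. z j = x (- j)" "\<forall>j\<ge>- m + int L. z j = x' (- j)"
      using x(2) by (auto simp: mir.fibre_def fibre_def mirror_image_iff mirror_inj)
    then show ?thesis
      by (intro bexI[of _ "mirror z"]) (auto simp: fibre_def)
  qed
  then show ?thesis using L(1) by (intro exI[of _ L]) auto
qed

text \<open>If \<open>y\<close> has a minimal routing far to the left, \<open>x\<close> is routed there and leaves the routing, in the same
  state, along a preimage of \<open>y\<close>. This lift agrees with \<open>x\<close> much too briefly, but both lie over \<open>y\<close> up to
  \<open>0\<close>, so the departure can be postponed until \<open>- L\<close>. An arbitrary \<open>x\<close> is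
  approximated by points whose far left end is exchanged for one with a minimal routing.\<close>

lemma right_continuing:
  assumes closing: "right_class_closing X \<pi>"
  shows "\<exists>L::nat. \<forall>x\<in>X. \<forall>y\<in>Y. \<forall>p. (\<forall>j\<le>p. \<pi> x j = y j) \<longrightarrow> (\<exists>x'\<in>fibre y. \<forall>j\<le>p - int L. x' j = x j)"
proof -
  obtain L :: nat where L: "\<forall>x\<in>X. \<forall>x'\<in>X. \<forall>p m. p \<le> m \<longrightarrow>
    (\<forall>j\<le>p. x j = x' j) \<longrightarrow> (\<forall>j\<le>m + int L. \<pi> x j = \<pi> x' j) \<longrightarrow>
      (\<exists>z\<in>fibre (\<pi> x'). (\<forall>j\<le>m. z j = x j) \<and> (\<forall>j\<ge>m + int L. z j = x' j))"
    using right_closing_uniform[OF closing] by blast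
  have routed: "\<exists>x'\<in>fibre y. \<forall>j. b \<le> j \<and> j \<le> - int L \<longrightarrow> x' j = x j"
    if mr: "minimal_routing y a b n M" and b: "b \<le> - int L" and x: "x \<in> X" and eq: "\<And>j. j \<le> 0 \<Longrightarrow> \<pi> x j = y j"
    for x y a b n M
  proof -
    note D = minimal_routingD[OF mr]
    obtain w where w: "w \<in> fibre (\<pi> x)" "\<And>j. j \<le> a \<or> b \<le> j \<Longrightarrow> w j = x j" "state w n \<in> M"
      using routingE[OF D(2) x] eq b by (metis dual_order.trans of_nat_0_le_iff neg_le_0_iff_le)
    obtain e where e: "e \<in> fibre y" "state e n = state w n"
      using minimal_routing_state_realized[OF mr w(3)] .
    \<comment> \<open>v is the lift of y that leaves w at n.\<close>
    define v where "v = splice n w e"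
    have v: "v \<in> fibre y"
      unfolding v_def
    proof (rule splice_fibre)
      show "\<pi> w j = y j" if "j < n + int r" for j
        using fibreD(2)[OF w(1)] eq[of j] that D(5) b radius by simp
    qed (use w(1) e in \<open>auto simp: fibre_def\<close>)
    have "\<exists>z\<in>fibre (\<pi> v). (\<forall>j\<le>- int L. z j = w j) \<and> (\<forall>j\<ge>- int L + int L. z j = v j)"
    proof (rule L[rule_format, of w v n "- int L"])
      show "w j = v j" if "j \<le> n" for j
        using splice_left[OF e(2)[symmetric], of j] that radius by (simp add: v_def)
      show "n \<le> - int L" using D(5) b by simp
      show "\<pi> w j = \<pi> v j" if "j \<le> - int L + int L" for j
        using that eq[of j] fibreD(2)[OF v] fibreD(2)[OF w(1)] by simp
    qed (use w(1) v in \<open>auto simp: fibre_def\<close>)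
    then obtain z where "z \<in> fibre y" "\<forall>j\<le>- int L. z j = w j"
      using fibreD(2)[OF v] by auto
    then show ?thesis using w(2) by (intro bexI[of _ z]) auto
  qed
  have at_0: "\<exists>x'\<in>fibre y. \<forall>j\<le>- int L. x' j = x j"
    if x: "x \<in> X" and y: "y \<in> Y" and eq: "\<And>j. j \<le> 0 \<Longrightarrow> \<pi> x j = y j" for x y
  proof -
    obtain y0 a b n M where mr: "minimal_routing y0 a b n M"
      using minimal_routing_exists y by blast
    note D = minimal_routingD[OF mr]
    obtain e where e: "e \<in> fibre y0" using fibre_nonempty[OF D(1)] by blast
    have "\<exists>x'\<in>X. agree (int N) (\<pi> x') y \<and> (\<forall>j. - int N \<le> j \<and> j \<le> - int L \<longrightarrow> x' j = x j)" for N
    proof -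
      \<comment> \<open>xk is x from - k on with a minimal routing further left, and yk continues its image by y.\<close>
      define k where "k = int N + int L + 2 * int K"
      have k: "int L \<le> k" "int N \<le> k" "2 * int K \<le> k" "int N + int r \<le> k" using radius by (auto simp: k_def)
      obtain u T where u: "u \<in> X" "b + int r < - k + T" "\<And>j. j \<le> b + int r \<Longrightarrow> u j = e j"
        "\<And>j. - k \<le> j \<Longrightarrow> u (j + T) = x j"
        using dom.join[OF fibreD(1)[OF e] x, of "b + int r" "- k"] by metis
      define xk where "xk = translate T u"
      have xk: "xk \<in> X" "\<And>j. - k \<le> j \<Longrightarrow> xk j = x j"
        using dom.translate u by (auto simp: xk_def)
      have far: "\<pi> xk j = y0 (j + T)" if "j \<le> b - T" for j
      proof -
        have "\<pi> u (j + T) = \<pi> e (j + T)"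
          using that u(3) by (intro local_rule u(1) fibreD(1)[OF e]) auto
        then show ?thesis using fibreD(2)[OF e] translate[OF u(1)] by (simp add: xk_def)
      qed
      have near: "\<pi> xk j = \<pi> x j" if "- k + int r \<le> j" for j
        using that xk by (intro local_rule x) auto
      define yk where "yk = splice (- k + int r) (\<pi> xk) y"
      have ykY: "yk \<in> Y"
        unfolding yk_def using near eq k radius
        by (intro cod.splice image_in xk(1) y) auto
      have yk: "\<pi> xk j = yk j" if "j \<le> 0" for j
        using near eq that by (auto simp: yk_def splice_apply)
      have "minimal_routing yk (a - T) (b - T) (n - T) M"
        by (rule minimal_routing_cong[OF minimal_routing_translate[OF mr, of T] ykY])
           (use yk far u(2) k in \<open>auto\<close>)
      then obtain x' where x': "x' \<in> fibre yk" "\<forall>j. b - T \<le> j \<and> j \<le> - int L \<longrightarrow> x' j = xk j"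
        using routed[OF _ _ xk(1) yk] u(2) k by force
      have "agree (int N) (\<pi> x') y"
        using k fibreD(2)[OF x'(1)] by (auto simp: agree_def yk_def splice_apply)
      then show ?thesis
        using x' xk(2) u(2) k by (intro bexI[of _ x']) (auto simp: fibre_def)
    qed
    then obtain s where s: "\<And>N::nat. s N \<in> X" "\<And>N. agree (int N) (\<pi> (s N)) y"
      "\<And>N j. - int N \<le> j \<Longrightarrow> j \<le> - int L \<Longrightarrow> s N j = x j"
      by metis
    obtain x' where x': "x' \<in> fibre y" "\<And>N::nat. \<exists>k\<ge>N. agree (int N) (s k) x'"
      using fibre_cluster_point[of s, OF s(1,2)] by blast
    have "x' j = x j" if "j \<le> - int L" for j
    proof -
      obtain k where "k \<ge> nat \<bar>j\<bar>" "agree (int (nat \<bar>j\<bar>)) (s k) x'" using x'(2) by blast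
      then show ?thesis using s(3)[of k j] that agreeD[of _ "s k" x' j] by simp
    qed
    then show ?thesis using x'(1) by blast
  qed
  have "\<exists>x'\<in>fibre y. \<forall>j\<le>p - int L. x' j = x j"
    if x: "x \<in> X" "y \<in> Y" and eq: "\<And>j. j \<le> p \<Longrightarrow> \<pi> x j = y j" for x y p
  proof -
    have "\<exists>x'\<in>fibre (translate p y). \<forall>j\<le>- int L. x' j = translate p x j"
    proof (rule at_0)
      show "\<pi> (translate p x) j = translate p y j" if "j \<le> 0" for j
        unfolding translate[OF x(1)] translate_apply by (rule eq) (use that in simp)
    qed (use x dom.translate cod.translate in blast)+
    then obtain x' where x': "x' \<in> fibre (translate p y)" "\<forall>j\<le>- int L. x' j = x (j + p)" by auto
    have "translate (- p) x' \<in> fibre y"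
      using fibre_translate[OF x'(1), of "- p"] by simp
    moreover have "translate (- p) x' j = x j" if "j \<le> p - int L" for j
      using x'(2)[rule_format, of "j - p"] that by simp
    ultimately show ?thesis by blast
  qed
  then show ?thesis by (intro exI[of _ L]) auto
qed

text \<open>Here \<open>v\<close> is \<open>y\<close> up to \<open>q\<close>, followed by a minimal routing. The colour of \<open>x\<close> is the state in which its lift
  to \<open>v\<close> is routed. The distances \<open>L\<close>, \<open>N\<close> and \<open>K\<close> that are reserved between \<open>m\<close> and \<open>q\<close> account for the lift, the
  bridge and the return to \<open>x'\<close> at \<open>p\<close>, all of which take place where \<open>v\<close> equals \<open>y\<close>.\<close>

lemma bi_class_closing_num_right_classes_le:
  assumes right: "right_class_closing X \<pi>" and left: "left_class_closing X \<pi>" and y: "y \<in> Y"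
  shows "num_right_classes X \<pi> y \<le> depth"
proof (rule right_classes_le_colours(2))
  fix m
  obtain L :: nat where L:
    "\<forall>x\<in>X. \<forall>y\<in>Y. \<forall>p. (\<forall>j\<le>p. \<pi> x j = y j) \<longrightarrow> (\<exists>x'\<in>fibre y. \<forall>j\<le>p - int L. x' j = x j)"
    using right_continuing[OF right] by blast
  obtain N :: nat where N: "N \<ge> 1"
    "\<forall>y. \<forall>x\<in>fibre y. \<forall>x'\<in>fibre y. \<forall>p m. m \<le> p \<longrightarrow> (\<forall>j\<ge>p. x j = x' j) \<longrightarrow>
      (\<exists>z\<in>fibre y. (\<forall>j\<ge>m. z j = x j) \<and> (\<forall>j\<le>m - int N. z j = x' j))"
    using left_closing_uniform[OF left] by blast
  obtain y0 a0 b0 n0 M where mr0: "minimal_routing y0 a0 b0 n0 M"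
    using minimal_routing_exists y by blast
  define p where "p = m + int N"
  define q where "q = p + int K + int L"
  obtain v T where v: "v \<in> Y" "q < a0 + T" "\<And>j. j \<le> q \<Longrightarrow> v j = y j" "\<And>j. a0 \<le> j \<Longrightarrow> v (j + T) = y0 j"
    using cod.join[OF y minimal_routingD(1)[OF mr0], of q a0] by metis
  define a b n where "a = a0 + T" and "b = b0 + T" and "n = n0 + T"
  have mr: "minimal_routing v a b n M"
    by (rule minimal_routing_cong[OF _ v(1)], use minimal_routing_translate[OF mr0, of "- T"] in \<open>simp add: a_def b_def n_def\<close>)
       (use v(4)[of "j - T" for j] in \<open>simp add: a_def b_def\<close>)
  note D = minimal_routingD[OF mr]
  have qa: "q < a" using v(2) by (simp add: a_def)
  have "\<exists>w\<in>fibre v. (\<forall>j\<le>p + int K. w j = x j) \<and> state w n \<in> M" if x: "x \<in> fibre y" for x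
  proof -
    have "\<exists>x'\<in>fibre v. \<forall>j\<le>q - int L. x' j = x j"
      using v(3) fibreD[OF x] by (intro L[rule_format] v(1)) auto
    then obtain x' where x': "x' \<in> fibre v" "\<forall>j\<le>q - int L. x' j = x j" by blast
    obtain w where w: "w \<in> fibre (\<pi> x')" "\<And>j. j \<le> a \<or> b \<le> j \<Longrightarrow> w j = x' j" "state w n \<in> M"
      using routingE[OF D(2) fibreD(1)[OF x'(1)]] fibreD(2)[OF x'(1)] by metis
    then show ?thesis
      using x' qa fibreD(2)[OF x'(1)] by (intro bexI[of _ w]) (auto simp: q_def)
  qed
  then obtain w where w: "\<And>x. x \<in> fibre y \<Longrightarrow> w x \<in> fibre v"
    "\<And>x j. x \<in> fibre y \<Longrightarrow> j \<le> p + int K \<Longrightarrow> w x j = x j"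
    "\<And>x. x \<in> fibre y \<Longrightarrow> state (w x) n \<in> M"
    by metis
  have "\<exists>z. right_bridge X \<pi> m x x' z"
    if x: "x \<in> fibre y" "x' \<in> fibre y" and col: "state (w x) n = state (w x') n" for x x'
  proof -
    \<comment> \<open>u is right asymptotic to w x and follows w x' before the routing.\<close>
    define u where "u = splice n (w x') (w x)"
    have pn: "p + int K < n" using qa D(4) by (simp add: q_def)
    have "u \<in> fibre v"
      unfolding u_def using splice_same_fibre[OF w(1)[OF x(2)] w(1)[OF x(1)]] col by simp
    then obtain z where z: "z \<in> fibre v" "\<forall>j\<ge>p. z j = u j" "\<forall>j\<le>p - int N. z j = w x j"
      using N(2)[rule_format, of u v "w x" p n] w(1)[OF x(1)] pn by (auto simp: u_def splice_apply)
    have e: "state z p = state x' p"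
      using z(2) w(2)[OF x(2)] pn by (intro state_eqI) (auto simp: u_def splice_apply)
    have "splice p z x' \<in> fibre y"
    proof (rule splice_fibre)
      show "\<pi> z j = y j" if "j < p + int r" for j
        using fibreD(2)[OF z(1)] v(3)[of j] that radius by (simp add: q_def)
    qed (use z(1) x(2) e in \<open>auto simp: fibre_def\<close>)
    moreover have "splice p z x' j = x j" if "j \<le> m" for j
      using that z(3) w(2)[OF x(1), of j] N(1) by (simp add: splice_apply p_def)
    ultimately have "right_bridge X \<pi> m x x' (splice p z x')"
      unfolding right_bridge_fibre[OF x(1)] using N(1)
      by (auto intro!: exI[of _ p] simp: p_def splice_apply)
    then show ?thesis by blast
  qed
  then show "\<exists>g :: (int \<Rightarrow> 'a) \<Rightarrow> 'a list. \<exists>S. finite S \<and> card S \<le> depth \<and> g ` fibre y \<subseteq> S \<and>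
      (\<forall>x\<in>fibre y. \<forall>x'\<in>fibre y. g x = g x' \<longrightarrow> (\<exists>z. right_bridge X \<pi> m x x' z))"
    using w(3) D(3,6) by (intro exI[of _ "\<lambda>x. state (w x) n"] exI[of _ M]) auto
qed

theorem bi_class_closing_iff_constant: "bi_class_closing X \<pi> \<longleftrightarrow> constant_class_to_one X Y \<pi>"
proof
  assume "bi_class_closing X \<pi>"
  then have "num_right_classes X \<pi> y = depth" if "y \<in> Y" for y
    using bi_class_closing_num_right_classes_le[OF _ _ that] depth_le_num_right_classes[OF that]
    by (auto simp: bi_class_closing_def)
  then show "constant_class_to_one X Y \<pi>" by (simp add: constant_iff_depth)
next
  assume "constant_class_to_one X Y \<pi>"
  then show "bi_class_closing X \<pi>"
    using constant_imp_right_class_closing constant_imp_left_class_closing by (simp add: bi_class_closing_def)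
qed

end

theorem corollary5p7:
  fixes X :: "(int \<Rightarrow> 'a::finite) set"
    and Y :: "(int \<Rightarrow> 'b::finite) set"
    and \<pi> :: "(int \<Rightarrow> 'a) \<Rightarrow> (int \<Rightarrow> 'b)"
  assumes "irreducible_shift X" and "shift_of_finite_type X"
    and "irreducible_shift Y" and "shift_of_finite_type Y"
    and "factor_code X Y \<pi>"
  shows "bi_class_closing X \<pi> \<longleftrightarrow> constant_class_to_one X Y \<pi>"
proof -
  obtain k where k: "\<And>x x' i. \<lbrakk>x \<in> X; x' \<in> X; \<forall>j. i \<le> j \<and> j < i + int k \<longrightarrow> x j = x' j\<rbrakk> \<Longrightarrow> splice i x x' \<in> X"
    using finite_type_splice[OF assms(2)] by blast
  obtain l where l: "\<And>x x' i. \<lbrakk>x \<in> Y; x' \<in> Y; \<forall>j. i \<le> j \<and> j < i + int l \<longrightarrow> x j = x' j\<rbrakk> \<Longrightarrow> splice i x x' \<in> Y"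
    using finite_type_splice[OF assms(4)] by blast
  have X: "closedin full_shift_topology X" "shift ` X = X"
    using assms(2) by (auto simp: shift_of_finite_type_def shift_space_def)
  obtain r :: nat where r: "\<And>x x' j. \<lbrakk>x \<in> X; x' \<in> X; \<forall>k. \<bar>k - j\<bar> \<le> int r \<longrightarrow> x k = x' k\<rbrakk> \<Longrightarrow> \<pi> x j = \<pi> x' j"
    using factor_code_local[OF X assms(5)] by blast
  define K where "K = k + l + (2 * r + 1)"
  interpret class_code X Y K \<pi> r
  proof (intro class_code.intro class_code_axioms.intro)
    show "irreducible_sft X K"
      by (rule irreducible_sftI[OF assms(1)], rule k) (auto simp: K_def)
    show "irreducible_sft Y K"
      by (rule irreducible_sftI[OF assms(3)], rule l) (auto simp: K_def)
    show "\<pi> ` X = Y" using assms(5) by (simp add: factor_code_def)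
    show "\<pi> (translate t x) = translate t (\<pi> x)" if "x \<in> X" for t x
      using factor_code_translate[OF X(2) assms(5) that] .
    show "\<pi> x j = \<pi> x' j" if "x \<in> X" "x' \<in> X" "\<And>k. \<bar>k - j\<bar> \<le> int r \<Longrightarrow> x k = x' k" for x x' j
      using r that by blast
  qed (simp add: K_def)
  show ?thesis by (rule bi_class_closing_iff_constant)
qed

end
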